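(* Let $T>0$. Assume that the control system $\dot u^c(t)=Au^c(t)+Bv(t)$, $t\ge 0$, $u^c(0)=x$, is approximate null controllable in time $T$. Assume that the Lévy measure $\nu$ has a density $k$ and that there exist an index $\alpha\in(1,2]$ and constants $K_0>0$, $r_0>0$ such that $k(r)=K_0|r|^{-\alpha-1}$ for all $|r|\ge r_0$. Fix $x\in H$ and let $u(\cdot,x)$ be a solution of $$du(t,x)=Au(t,x)\,dt+\int_{\mathbb{R}}B\,z\,\tilde\eta(dz,dt),\qquad u(0,x)=x .$$ Then for any $\delta>0$ there exists $\kappa>0$ such that $$\mathbb{P}\big(u(T,x)\in \mathcal{D}_H(\delta)\big)\ge\kappa .$$
   Context: $H$ is a Hilbert space and $A$ is the generator of a strongly continuous semigroup on $H$; following the paper this semigroup is denoted $(e^{-tA})_{t\ge0}$. $B:\mathbb{R}\to D(A^{-\gamma})$ is a bounded linear operator for some $\gamma<\tfrac12$, where $D(A^{-\gamma})$ is the extrapolation space of $A$, i.e. the completion of $H$ under the norm $|(\lambda_0-A)^{-\gamma}\cdot|_H$ for $\lambda_0$ with sufficiently large real part; the semigroup is extended to this space. $\mathcal{D}_H(C):=\{z\in H:|z|\le C\}$ for $C>0$. Noise: $(\Omega,\mathcal F,(\mathcal F_t)_{t\ge0},\mathbb P)$ is a complete filtered probability space with right-continuous filtration; $\eta$ is a time-homogeneous Poisson random measure on $\mathbb{R}$ over it, with intensity $\nu$, a Lévy measure on $\mathbb{R}$ ($\nu(\{0\})=0$, $\int(|z|^2\wedge1)\,\nu(dz)<\infty$),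 and compensator $\nu(dz)\,dt$; $\tilde\eta$ is the compensated measure, $\tilde\eta(dz,dt)=\eta(dz,dt)-\nu(dz)\,dt$. Solutions are understood in the mild sense: $u(t,x)=e^{-tA}x+\int_0^t\int_{\mathbb R}e^{-(t-s)A}Bz\,\tilde\eta(dz,ds)$ in $H$. Control: for $x\in H$ and $v\in L^2([0,T];\mathbb{R})$, $u^c(\cdot,x,v)$ is the mild solution of $\dot u^c=Au^c+Bv$, $u^c(0,x,v)=x$. The system is approximate null controllable in time $T$ if for any $x\in H$ and $\varepsilon>0$ there is $v\in L^2([0,T];\mathbb{R})$ with $|u^c(T,x,v)|_H\le\varepsilon$. *)

theory Defs
  imports "HOL-Probability.Probability"
begin

section \<open>Strongly continuous semigroups and extrapolation spaces\<close>

definition strongly_continuous_semigroup :: "(real \<Rightarrow> 'a \<Rightarrow> 'a::real_normed_vector) \<Rightarrow> bool" where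
  "strongly_continuous_semigroup S \<longleftrightarrow>
     (\<forall>t\<ge>0. bounded_linear (S t)) \<and>
     (\<forall>x. S 0 x = x) \<and>
     (\<forall>s\<ge>0. \<forall>t\<ge>0. \<forall>x. S (s + t) x = S s (S t x)) \<and>
     (\<forall>x. continuous_on {0..} (\<lambda>t. S t x))"

text \<open>An unbounded operator is a function \<open>A\<close> together with its domain \<open>D\<close>;
  the values of \<open>A\<close> outside \<open>D\<close> are irrelevant.\<close>

definition is_generator ::
    "(real \<Rightarrow> 'a \<Rightarrow> 'a::real_normed_vector) \<Rightarrow> 'a set \<Rightarrow> ('a \<Rightarrow> 'a) \<Rightarrow> bool" where
  "is_generator S D A \<longleftrightarrow>
     D = {x. \<exists>y. ((\<lambda>h. (S h x - x) /\<^sub>R h) \<longlongrightarrow> y) (at_right 0)} \<and>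
     (\<forall>x\<in>D. ((\<lambda>h. (S h x - x) /\<^sub>R h) \<longlongrightarrow> A x) (at_right 0))"

definition exceeds_growth_bound ::
    "(real \<Rightarrow> 'a \<Rightarrow> 'a::real_normed_vector) \<Rightarrow> real \<Rightarrow> bool" where
  "exceeds_growth_bound S l \<longleftrightarrow>
     (\<exists>C. \<exists>w<l. \<forall>t\<ge>0. \<forall>x. norm (S t x) \<le> C * exp (w * t) * norm x)"

definition resolvent :: "'a set \<Rightarrow> ('a \<Rightarrow> 'a) \<Rightarrow> real \<Rightarrow> 'a \<Rightarrow> 'a::real_normed_vector" where
  "resolvent D A l y = (THE x. x \<in> D \<and> l *\<^sub>R x - A x = y)"

text \<open>\<open>neg_frac_power D A l g\<close> is \<open>(l - A)\<close> to the power \<open>-g\<close>, for \<open>0 \<le> g < 1\<close>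
  and \<open>l\<close> above the growth bound, given by Balakrishnan's formula.\<close>

definition neg_frac_power ::
    "'a set \<Rightarrow> ('a \<Rightarrow> 'a) \<Rightarrow> real \<Rightarrow> real \<Rightarrow> 'a \<Rightarrow> 'a::real_normed_vector" where
  "neg_frac_power D A l g x =
     (if g = 0 then x
      else (sin (pi * g) / pi) *\<^sub>R
             integral {0<..} (\<lambda>s. (s powr (- g)) *\<^sub>R resolvent D A (l + s) x))"

text \<open>The Banach space \<open>'e\<close> with the embedding \<open>j\<close> is a completion of the Hilbert space \<open>'a\<close>
  under the given norm \<open>N\<close>. Completions are unique only up to isometry, so they
  are described by this property instead of one fixed construction.\<close>

definition is_completion :: "('a::real_vector \<Rightarrow> real) \<Rightarrow> ('a \<Rightarrow> 'e::banach) \<Rightarrow> bool" where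
  "is_completion N j \<longleftrightarrow>
     linear j \<and> inj j \<and> (\<forall>x. norm (j x) = N x) \<and> closure (range j) = UNIV"

definition extrapolation_space ::
    "'a set \<Rightarrow> ('a \<Rightarrow> 'a) \<Rightarrow> real \<Rightarrow> real \<Rightarrow> ('a::real_normed_vector \<Rightarrow> 'e::banach) \<Rightarrow> bool" where
  "extrapolation_space D A l g j \<longleftrightarrow> is_completion (\<lambda>x. norm (neg_frac_power D A l g x)) j"

text \<open>Since \<open>j\<close> has dense range, the extension \<open>SE t\<close> of \<open>S t\<close> is unique.\<close>

definition extended_semigroup ::
    "(real \<Rightarrow> 'a \<Rightarrow> 'a::real_normed_vector) \<Rightarrow> ('a \<Rightarrow> 'e::banach) \<Rightarrow> (real \<Rightarrow> 'e \<Rightarrow> 'e) \<Rightarrow> bool" where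
  "extended_semigroup S j SE \<longleftrightarrow>
     (\<forall>t\<ge>0. bounded_linear (SE t) \<and> (\<forall>x. SE t (j x) = j (S t x)))"

section \<open>Control\<close>

definition L2_on :: "real \<Rightarrow> (real \<Rightarrow> real) \<Rightarrow> bool" where
  "L2_on T v \<longleftrightarrow>
     v \<in> borel_measurable (lebesgue_on {0..T}) \<and> integrable (lebesgue_on {0..T}) (\<lambda>s. (v s)\<^sup>2)"

text \<open>The mild solution is formed in the extrapolation space, where the convolution integral exists
  for every square-integrable control. The gauge integral is used because the library's Bochner
  integral is restricted to separable spaces.\<close>

definition control_mild_solution ::
    "(real \<Rightarrow> 'a \<Rightarrow> 'a::real_normed_vector) \<Rightarrow> ('a \<Rightarrow> 'e::banach) \<Rightarrow> (real \<Rightarrow> 'e \<Rightarrow> 'e) \<Rightarrow>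
     (real \<Rightarrow> 'e) \<Rightarrow> real \<Rightarrow> 'a \<Rightarrow> (real \<Rightarrow> real) \<Rightarrow> (real \<Rightarrow> 'e) \<Rightarrow> bool" where
  "control_mild_solution S j SE B T x v uc \<longleftrightarrow>
     (\<forall>t\<in>{0..T}. ((\<lambda>s. SE (t - s) (B (v s))) has_integral (uc t - j (S t x))) {0..t})"

definition approx_null_controllable ::
    "(real \<Rightarrow> 'a \<Rightarrow> 'a::real_normed_vector) \<Rightarrow> ('a \<Rightarrow> 'e::banach) \<Rightarrow> (real \<Rightarrow> 'e \<Rightarrow> 'e) \<Rightarrow>
     (real \<Rightarrow> 'e) \<Rightarrow> real \<Rightarrow> bool" where
  "approx_null_controllable S j SE B T \<longleftrightarrow>
     (\<forall>x. \<forall>\<epsilon>>0. \<exists>v uc y. L2_on T v \<and> control_mild_solution S j SE B T x v uc \<and>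
        uc T = j y \<and> norm y \<le> \<epsilon>)"

section \<open>Poisson random measures\<close>

definition usual_conditions :: "'w measure \<Rightarrow> (real \<Rightarrow> 'w measure) \<Rightarrow> bool" where
  "usual_conditions M F \<longleftrightarrow>
     prob_space M \<and> complete_measure M \<and>
     (\<forall>t\<ge>0. subalgebra M (F t)) \<and>
     (\<forall>s t. 0 \<le> s \<longrightarrow> s \<le> t \<longrightarrow> sets (F s) \<subseteq> sets (F t)) \<and>
     (\<forall>t\<ge>0. sets (F t) = (\<Inter>s\<in>{t<..}. sets (F s))) \<and>
     null_sets M \<subseteq> sets (F 0)"

definition levy_measure :: "real measure \<Rightarrow> bool" where
  "levy_measure \<nu> \<longleftrightarrow>
     sets \<nu> = sets borel \<and> emeasure \<nu> {0} = 0 \<and>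
     (\<integral>\<^sup>+z. ennreal (min (z\<^sup>2) 1) \<partial>\<nu>) < \<infinity>"

text \<open>The compensator \<open>\<nu>(dz) dt\<close>, as a measure on pairs \<open>(z, t)\<close> that vanishes for \<open>t < 0\<close>.\<close>

definition compensator :: "real measure \<Rightarrow> (real \<times> real) measure" where
  "compensator \<nu> = \<nu> \<Otimes>\<^sub>M density lborel (indicator {0..})"

definition poisson_random_measure ::
    "'w measure \<Rightarrow> (real \<Rightarrow> 'w measure) \<Rightarrow> real measure \<Rightarrow> ('w \<Rightarrow> (real \<times> real) measure) \<Rightarrow> bool" where
  "poisson_random_measure M F \<nu> \<eta> \<longleftrightarrow>
     (\<forall>\<omega>\<in>space M. sets (\<eta> \<omega>) = sets (compensator \<nu>) \<and>
        (\<forall>A\<in>sets (compensator \<nu>). emeasure (\<eta> \<omega>) A \<in> insert \<infinity> (range of_nat))) \<and>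
     (\<forall>A\<in>sets (compensator \<nu>). (\<lambda>\<omega>. emeasure (\<eta> \<omega>) A) \<in> borel_measurable M) \<and>
     (\<forall>A\<in>sets (compensator \<nu>). emeasure (compensator \<nu>) A < \<infinity> \<longrightarrow>
        (\<forall>n. measure M {\<omega>\<in>space M. emeasure (\<eta> \<omega>) A = of_nat n} =
          measure (compensator \<nu>) A ^ n / fact n * exp (- measure (compensator \<nu>) A))) \<and>
     (\<forall>A\<in>sets (compensator \<nu>). emeasure (compensator \<nu>) A = \<infinity> \<longrightarrow>
        (AE \<omega> in M. emeasure (\<eta> \<omega>) A = \<infinity>)) \<and>
     (\<forall>A :: nat \<Rightarrow> (real \<times> real) set. range A \<subseteq> sets (compensator \<nu>) \<longrightarrow> disjoint_family A \<longrightarrow>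
        prob_space.indep_vars M (\<lambda>_. borel) (\<lambda>n \<omega>. emeasure (\<eta> \<omega>) (A n)) UNIV) \<and>
     (\<forall>U\<in>sets borel. \<forall>t\<ge>0. (\<lambda>\<omega>. emeasure (\<eta> \<omega>) (U \<times> {0<..t})) \<in> borel_measurable (F t)) \<and>
     (\<forall>U\<in>sets borel. \<forall>s\<ge>0. \<forall>t>s. prob_space.indep_set M (sets (F s))
        {(\<lambda>\<omega>. emeasure (\<eta> \<omega>) (U \<times> {s<..t})) -` V \<inter> space M |V. V \<in> sets borel})"

section \<open>The compensated Poisson integral\<close>

definition converges_in_probability ::
    "'w measure \<Rightarrow> (nat \<Rightarrow> 'w \<Rightarrow> 'a::real_normed_vector) \<Rightarrow> ('w \<Rightarrow> 'a) \<Rightarrow> bool" where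
  "converges_in_probability M X Y \<longleftrightarrow>
     (\<forall>\<epsilon>>0. (\<lambda>n. measure M {\<omega>\<in>space M. norm (X n \<omega> - Y \<omega>) > \<epsilon>}) \<longlonglongrightarrow> 0)"

text \<open>\<open>X\<close> is the integral of the deterministic integrand \<open>\<Phi>\<close> against \<open>\<eta> - compensator \<nu>\<close>, obtained
  from simple integrands by continuity. Approximation is in \<open>L\<^sup>1 + L\<^sup>2\<close> of the compensator, metrised
  by the integral of \<open>min r r\<^sup>2\<close>: \<open>L\<^sup>2\<close> alone would exclude jumps without second moment.\<close>

definition compensated_integral ::
    "'w measure \<Rightarrow> real measure \<Rightarrow> ('w \<Rightarrow> (real \<times> real) measure) \<Rightarrow>
     (real \<times> real \<Rightarrow> 'a::real_normed_vector) \<Rightarrow> ('w \<Rightarrow> 'a) \<Rightarrow> bool" where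
  "compensated_integral M \<nu> \<eta> \<Phi> X \<longleftrightarrow>
     \<Phi> \<in> borel_measurable (compensator \<nu>) \<and> X \<in> borel_measurable M \<and>
     (\<exists>\<phi>. (\<forall>n. Bochner_Integration.simple_bochner_integrable (compensator \<nu>) (\<phi> n)) \<and>
        (\<lambda>n. \<integral>\<^sup>+p. ennreal (min (norm (\<phi> n p - \<Phi> p)) ((norm (\<phi> n p - \<Phi> p))\<^sup>2)) \<partial>compensator \<nu>)
          \<longlonglongrightarrow> 0 \<and>
        converges_in_probability M
          (\<lambda>n \<omega>. Bochner_Integration.simple_bochner_integral (\<eta> \<omega>) (\<phi> n) -
                 Bochner_Integration.simple_bochner_integral (compensator \<nu>) (\<phi> n)) X)"

text \<open>The integral is an integral in \<open>H\<close>: \<open>\<Phi>\<close> is the \<open>H\<close>-valued version of the integrand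
  \<open>SE (t - s) (B z)\<close> on \<open>0 \<le> s \<le> t\<close>.\<close>

definition spde_mild_solution ::
    "'w measure \<Rightarrow> (real \<Rightarrow> 'w measure) \<Rightarrow> real measure \<Rightarrow> ('w \<Rightarrow> (real \<times> real) measure) \<Rightarrow>
     (real \<Rightarrow> 'a \<Rightarrow> 'a::real_normed_vector) \<Rightarrow> ('a \<Rightarrow> 'e::banach) \<Rightarrow> (real \<Rightarrow> 'e \<Rightarrow> 'e) \<Rightarrow>
     (real \<Rightarrow> 'e) \<Rightarrow> 'a \<Rightarrow> (real \<Rightarrow> 'w \<Rightarrow> 'a) \<Rightarrow> bool" where
  "spde_mild_solution M F \<nu> \<eta> S j SE B x u \<longleftrightarrow>
     (\<forall>t\<ge>0. u t \<in> borel_measurable (F t) \<and>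
        (\<exists>\<Phi> X.
           (AE (z, s) in compensator \<nu>.
              if s \<in> {0..t} then j (\<Phi> (z, s)) = SE (t - s) (B z) else \<Phi> (z, s) = 0) \<and>
           compensated_integral M \<nu> \<eta> \<Phi> X \<and>
           (AE \<omega> in M. u t \<omega> = S t x + X \<omega>)))"

end

theory Submission
  imports Defs "HOL-Real_Asymp.Real_Asymp"
begin

text \<open>
  Write \<open>X\<close> for the stochastic integral at time \<open>T\<close>, \<open>b = B 1\<close>, and \<open>g t\<close> for the Hilbert space
  version of \<open>SE t b\<close>, so that the integrand is \<open>z *\<^sub>R g (T - s)\<close>. A single jump of size close to \<open>z\<close>
  at a time close to \<open>s\<close> is independent of all other jumps, has positive probability, and may be taken
  from a set of arbitrarily small intensity; hence the support of the law of \<open>X\<close> is invariant under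
  translation by \<open>z *\<^sub>R g (T - s)\<close> whenever \<open>\<bar>z\<bar> > r0\<close>. Every real number is a sum of two numbers of
  modulus greater than \<open>r0\<close>, so the support is invariant under the closed linear span \<open>V\<close> of the \<open>g t\<close>,
  \<open>0 < t < T\<close>. Moreover \<open>X\<close> has values in \<open>V\<close>, and approximate null controllability says that
  \<open>S T x\<close> lies in \<open>V\<close>. Therefore \<open>- S T x\<close> belongs to the support.
\<close>

section \<open>Integration of continuous functions in a Hilbert space\<close>

text \<open>The existence of \<open>g\<close> is extracted from the solution: its integrand has a
  Hilbert space version at almost every time and jump size, which forces \<open>SE t b\<close> into
  the range of \<open>j\<close> for arbitrarily small \<open>t\<close>, hence for all
  \<open>t > 0\<close>. Small intensity matters because the event that \<open>X\<close> is near a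
  point must retain outcomes without any jump in the chosen set. Only there is the remaining noise,
  which is independent of the added jump, seen to be near that point. The main obstacle is that the
  control integral lives in the extrapolation space while \<open>V\<close> lies in the Hilbert
  space. Comparing the two calls for continuity of \<open>j\<close>, which comes from the resolvent
  estimate through Balakrishnan's formula. A second obstacle is that the Hilbert space may be
  nonseparable. Measurability is therefore claimed for norms rather than for sums of vectors, and
  the support enters only through balls of positive probability, whose centres may depend on the
  radius.\<close>

lemma norm_blinfun_inner_right: "norm (blinfun_inner_right x) = norm (x :: 'a::real_inner)"
proof (rule antisym)
  show "norm (blinfun_inner_right x) \<le> norm x"
    by (rule norm_blinfun_bound) (auto simp: Cauchy_Schwarz_ineq2)
  show "norm x \<le> norm (blinfun_inner_right x)"
  proof (cases "x = 0")
    case False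
    have "norm x * norm x = norm (blinfun_apply (blinfun_inner_right x) x)"
      by (simp add: power2_norm_eq_inner flip: power2_eq_square)
    also have "\<dots> \<le> norm (blinfun_inner_right x) * norm x"
      by (rule norm_blinfun)
    finally show ?thesis using False by simp
  qed simp
qed

text \<open>The sort \<open>{real_inner, complete_space}\<close> is not below \<open>banach\<close>, so the library's
  integrability theorem is applied in the dual space, into which the Hilbert space embeds isometrically.\<close>

lemma hilbert_integrable_continuous:
  fixes f :: "real \<Rightarrow> 'a::{real_inner,complete_space}"
  assumes "continuous_on {a..b} f"
  shows "f integrable_on {a..b}"
proof -
  let ?i = "blinfun_inner_right :: 'a \<Rightarrow> 'a \<Rightarrow>\<^sub>L real"
  interpret i: bounded_linear ?i by (rule bounded_linear_blinfun_inner_right)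
  have "continuous_on {a..b} (\<lambda>t. ?i (f t))"
    by (intro i.continuous_on assms)
  then obtain J where J: "((\<lambda>t. ?i (f t)) has_integral J) {a..b}"
    using integrable_continuous_real by blast
  define R where "R p = (\<Sum>(x,K)\<in>p. measure lborel K *\<^sub>R f x)" for p :: "(real \<times> real set) set"
  have iR: "(\<Sum>(x,K)\<in>p. measure lborel K *\<^sub>R ?i (f x)) = ?i (R p)" for p :: "(real \<times> real set) set"
    by (simp add: R_def i.sum case_prod_unfold i.scaleR)
  have J': "\<exists>\<gamma>. gauge \<gamma> \<and> (\<forall>p. p tagged_division_of {a..b} \<and> \<gamma> fine p \<longrightarrow> norm (?i (R p) - J) < e)"
    if "e > 0" for e
    using J[unfolded has_integral_real iR] that by blast
  have ex: "\<exists>p. norm (?i (R p) - J) < e" if "e > 0" for e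
  proof -
    obtain \<gamma> where \<gamma>: "gauge \<gamma>" "\<forall>p. p tagged_division_of {a..b} \<and> \<gamma> fine p \<longrightarrow> norm (?i (R p) - J) < e"
      using J'[OF \<open>e > 0\<close>] by blast
    obtain p where "p tagged_division_of {a..b}" "\<gamma> fine p"
      by (rule fine_division_exists_real[OF \<gamma>(1)])
    then show ?thesis using \<gamma>(2) by blast
  qed
  \<comment> \<open>Riemann sums whose images approach \<open>J\<close>. As the embedding is
    isometric they are Cauchy in the Hilbert space, so \<open>J\<close> is itself the image of a
    vector.\<close>
  have "\<forall>n. \<exists>p. norm (?i (R p) - J) < 1 / real (Suc n)"
    using ex by simp
  then obtain P where P: "norm (?i (R (P n)) - J) < 1 / real (Suc n)" for n
    by metis
  have lim: "(\<lambda>n. ?i (R (P n))) \<longlonglongrightarrow> J"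
    using LIMSEQ_norm_0[OF P] by (simp add: Lim_null[of _ J])
  have "Cauchy (\<lambda>n. R (P n))"
    using LIMSEQ_imp_Cauchy[OF lim] unfolding Cauchy_def dist_norm
    by (simp add: norm_blinfun_inner_right flip: i.diff)
  then obtain I where I: "(\<lambda>n. R (P n)) \<longlonglongrightarrow> I"
    using Cauchy_convergent convergent_def by blast
  have "J = ?i I"
    using LIMSEQ_unique[OF lim i.tendsto[OF I]] .
  then have "norm (?i (R p) - J) = norm (R p - I)" for p
    by (simp add: norm_blinfun_inner_right flip: i.diff)
  then have "(f has_integral I) {a..b}"
    unfolding has_integral_real R_def[symmetric] using J' by auto
  then show ?thesis by blast
qed

lemma integral_inner_left:
  fixes f :: "real \<Rightarrow> 'a::real_inner"
  assumes "f integrable_on X"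
  shows "integral X (\<lambda>t. f t \<bullet> w) = integral X f \<bullet> w" "(\<lambda>t. f t \<bullet> w) integrable_on X"
  using has_integral_linear[OF integrable_integral[OF assms] bounded_linear_inner_left[of w]]
  by (auto simp: o_def integral_unique)

text \<open>Pairing with each vector \<open>w\<close> reduces additivity to real integrands.\<close>

lemma hilbert_integral_combine:
  fixes f :: "real \<Rightarrow> 'a::{real_inner,complete_space}"
  assumes c: "continuous_on {a..b} f" and "a \<le> c" "c \<le> b"
  shows "integral {a..c} f + integral {c..b} f = integral {a..b} f"
proof -
  have i: "f integrable_on {a..b}" "f integrable_on {a..c}" "f integrable_on {c..b}"
    using assms by (auto intro!: hilbert_integrable_continuous elim: continuous_on_subset)
  have "(integral {a..c} f + integral {c..b} f) \<bullet> w = integral {a..b} f \<bullet> w" for w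
    using Henstock_Kurzweil_Integration.integral_combine[OF assms(2,3) integral_inner_left(2)[OF i(1)]]
    by (simp add: integral_inner_left[OF i(1)] integral_inner_left[OF i(2)] integral_inner_left[OF i(3)] inner_add_left)
  then show ?thesis by (metis vector_eq_rdot)
qed

text \<open>Pairing the integral with itself turns its squared norm into a scalar integral, where
  the Cauchy-Schwarz inequality and monotonicity apply.\<close>

lemma norm_integral_le_dominated:
  fixes f :: "real \<Rightarrow> 'a::real_inner"
  assumes f: "f integrable_on X" and g: "g integrable_on X"
    and le: "\<And>t. t \<in> X \<Longrightarrow> norm (f t) \<le> g t"
  shows "norm (integral X f) \<le> integral X g"
proof (cases "integral X f = 0")
  case True
  then show ?thesis using integral_nonneg[OF g] le norm_ge_zero order_trans
    by (metis norm_zero)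
next
  case False
  let ?w = "integral X f"
  have "norm ?w * norm ?w = integral X (\<lambda>t. f t \<bullet> ?w)"
    by (simp add: integral_inner_left(1)[OF f] flip: power2_norm_eq_inner power2_eq_square)
  also have "\<dots> \<le> integral X (\<lambda>t. g t * norm ?w)"
  proof (rule integral_le)
    show "(\<lambda>t. f t \<bullet> ?w) integrable_on X" by (rule integral_inner_left(2)[OF f])
    show "(\<lambda>t. g t * norm ?w) integrable_on X" using g by (rule integrable_on_mult_left)
    show "f t \<bullet> ?w \<le> g t * norm ?w" if "t \<in> X" for t
      using norm_cauchy_schwarz[of "f t" ?w] mult_right_mono[OF le[OF that], of "norm ?w"] by simp
  qed
  also have "\<dots> = integral X g * norm ?w" by simp
  finally show ?thesis using False by simp
qed

section \<open>Resolvent estimate and continuity of the embedding\<close>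

text \<open>With \<open>R t = exp (- l * t) S t\<close>, the element \<open>x\<close> is the telescoping sum of
  \<open>R (i h) (x - R h x)\<close>, and \<open>(x - R h x) / h\<close> tends to \<open>l x - a\<close>; no integral is needed.\<close>

lemma semigroup_norm_resolvent_le:
  fixes S :: "real \<Rightarrow> 'a::real_normed_vector \<Rightarrow> 'a"
  assumes S: "strongly_continuous_semigroup S"
    and bd: "\<And>t x. 0 \<le> t \<Longrightarrow> norm (S t x) \<le> C * exp (w * t) * norm x"
    and wl: "w < l"
    and gen: "((\<lambda>h. (S h x - x) /\<^sub>R h) \<longlongrightarrow> a) (at_right 0)"
  shows "(l - w) * norm x \<le> C * norm (l *\<^sub>R x - a)"
proof -
  \<comment> \<open>The rescaling subtracts \<open>l\<close> from the generator and makes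
    \<open>R\<close> decay at the rate \<open>l - w\<close>.\<close>
  define R where "R t z = exp (- l * t) *\<^sub>R S t z" for t z
  have lin: "bounded_linear (S t)" if "t \<ge> 0" for t
    using S that by (auto simp: strongly_continuous_semigroup_def)
  have add: "S (s + t) z = S s (S t z)" if "s \<ge> 0" "t \<ge> 0" for s t z
    using S that by (auto simp: strongly_continuous_semigroup_def)
  have S0: "S 0 z = z" for z
    using S by (auto simp: strongly_continuous_semigroup_def)
  have Rlin: "bounded_linear (R t)" if "t \<ge> 0" for t
    unfolding R_def by (intro bounded_linear_intros lin that)
  have Radd: "R (s + t) z = R s (R t z)" if "s \<ge> 0" "t \<ge> 0" for s t z
    using that by (simp add: R_def add linear_simps[OF lin] exp_add algebra_simps flip: exp_add)
  have Rbd: "norm (R t z) \<le> C * exp (- (l - w) * t) * norm z" if "t \<ge> 0" for t z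
  proof -
    have "norm (R t z) = exp (- l * t) * norm (S t z)" by (simp add: R_def)
    also have "\<dots> \<le> exp (- l * t) * (C * exp (w * t) * norm z)"
      using bd[OF that] by (intro mult_left_mono) auto
    also have "\<dots> = C * exp (- (l - w) * t) * norm z"
      by (simp add: algebra_simps flip: exp_add)
    finally show ?thesis .
  qed
  \<comment> \<open>At time 0 the growth bound reads \<open>norm z \<le> C * norm z\<close>, so
    \<open>C\<close> can be negative only in the trivial space.\<close>
  have C0: "0 \<le> C \<or> (\<forall>z::'a. z = 0)"
  proof (rule ccontr)
    assume "\<not> ?thesis"
    then obtain z :: 'a where "C < 0" "z \<noteq> 0" by auto
    then have "C * norm z < 0" by (simp add: mult_neg_pos)
    moreover have "norm z \<le> C * norm z" using bd[of 0 z] by (simp add: S0)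
    ultimately show False using norm_ge_zero[of z] by linarith
  qed
  have key: "(1 - exp (- (l - w) * h)) * norm x \<le> C * norm (x - R h x)" if h: "h > 0" for h
  proof (cases "x = 0")
    case False
    then have C: "0 \<le> C" using C0 by auto
    let ?q = "exp (- (l - w) * h)"
    have q: "0 < ?q" "?q < 1" using wl h by (auto simp: mult_neg_pos)
    have tel: "x = (\<Sum>i<n. R (real i * h) (x - R h x)) + R (real n * h) x" for n
    proof (induction n)
      case 0
      show ?case by (simp add: R_def S0)
    next
      case (Suc n)
      have "R (real (Suc n) * h) x = R (real n * h) (R h x)"
        using h by (subst Radd[symmetric]) (auto simp: algebra_simps)
      moreover have "R (real n * h) (x - R h x) = R (real n * h) x - R (real n * h) (R h x)"
        using h by (intro linear_simps Rlin) auto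
      ultimately show ?case using Suc.IH by simp
    qed
    have qn: "exp (- (l - w) * (real n * h)) = ?q ^ n" for n
      by (simp only: exp_of_nat_mult[symmetric]) (simp add: algebra_simps)
    \<comment> \<open>The telescoped pieces are dominated by a geometric series of ratio
      \<open>?q\<close>; the remainder vanishes as \<open>n\<close> grows.\<close>
    have "norm x \<le> C * norm (x - R h x) / (1 - ?q) + C * norm x * ?q ^ n" for n
    proof -
      have "(\<Sum>i<n. q ^ i) \<le> 1 / (1 - q)" if "0 < q" "q < 1" for q :: real
        using that by (simp add: sum_gp_strict divide_right_mono)
      from this[OF q] have geo: "(\<Sum>i<n. ?q ^ i) \<le> 1 / (1 - ?q)" .
      have "norm x \<le> (\<Sum>i<n. norm (R (real i * h) (x - R h x))) + norm (R (real n * h) x)"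
        by (subst tel[of n]) (intro norm_triangle_mono norm_sum order_refl)
      also have "\<dots> \<le> (\<Sum>i<n. C * ?q ^ i * norm (x - R h x)) + C * ?q ^ n * norm x"
        using Rbd[of "real _ * h", unfolded qn] h by (intro add_mono sum_mono) auto
      also have "\<dots> = C * norm (x - R h x) * (\<Sum>i<n. ?q ^ i) + C * norm x * ?q ^ n"
        by (simp add: sum_distrib_left algebra_simps)
      also have "\<dots> \<le> C * norm (x - R h x) * (1 / (1 - ?q)) + C * norm x * ?q ^ n"
        using C geo by (intro add_mono mult_left_mono) auto
      finally show ?thesis by simp
    qed
    moreover have "(\<lambda>n. C * norm (x - R h x) / (1 - ?q) + C * norm x * ?q ^ n) \<longlonglongrightarrow> C * norm (x - R h x) / (1 - ?q) + C * norm x * 0"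
      using q by (intro tendsto_intros LIMSEQ_power_zero) auto
    ultimately have "norm x \<le> C * norm (x - R h x) / (1 - ?q)"
      by (metis (no_types, lifting) LIMSEQ_le_const add.right_neutral mult_zero_right)
    then show ?thesis using q by (simp add: field_simps)
  qed (use Rlin[of h] h in \<open>simp add: linear_simps\<close>)
  have lim1: "((\<lambda>h. (1 - exp (- (l - w) * h)) / h * norm x) \<longlongrightarrow> (l - w) * norm x) (at_right 0)"
  proof -
    have "((\<lambda>h. (1 - exp (- c * h)) / h) \<longlongrightarrow> c) (at_right 0)" for c :: real
      by real_asymp
    then show ?thesis by (intro tendsto_mult tendsto_const)
  qed
  \<comment> \<open>This is \<open>(x - R h x) / h\<close>, split into the quotient of the
    exponential factor and that of \<open>S\<close>, whose limits are known separately.\<close>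
  have "((\<lambda>h. ((1 - exp (- l * h)) / h) *\<^sub>R x - exp (- l * h) *\<^sub>R ((S h x - x) /\<^sub>R h))
      \<longlongrightarrow> l *\<^sub>R x - 1 *\<^sub>R a) (at_right 0)"
  proof (intro tendsto_diff tendsto_scaleR tendsto_const gen)
    show "((\<lambda>h. (1 - exp (- l * h)) / h) \<longlongrightarrow> l) (at_right 0)" by real_asymp
    show "((\<lambda>h. exp (- l * h)) \<longlongrightarrow> 1) (at_right 0)" by real_asymp
  qed
  then have lim2: "((\<lambda>h. C * norm (((1 - exp (- l * h)) / h) *\<^sub>R x - exp (- l * h) *\<^sub>R ((S h x - x) /\<^sub>R h)))
      \<longlongrightarrow> C * norm (l *\<^sub>R x - a)) (at_right 0)"
    by (intro tendsto_mult tendsto_const tendsto_norm) simp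
  have ev: "\<forall>\<^sub>F h in at_right 0. (1 - exp (- (l - w) * h)) / h * norm x
      \<le> C * norm (((1 - exp (- l * h)) / h) *\<^sub>R x - exp (- l * h) *\<^sub>R ((S h x - x) /\<^sub>R h))"
    using eventually_at_right_less[of 0]
  proof eventually_elim
    case (elim h)
    have "((1 - exp (- l * h)) / h) *\<^sub>R x - exp (- l * h) *\<^sub>R ((S h x - x) /\<^sub>R h) = (x - R h x) /\<^sub>R h"
      by (simp add: R_def divide_inverse algebra_simps)
    then have "C * norm (((1 - exp (- l * h)) / h) *\<^sub>R x - exp (- l * h) *\<^sub>R ((S h x - x) /\<^sub>R h))
        = C * norm (x - R h x) / h"
      using elim by (simp add: divide_inverse)
    then show ?case using key[OF elim] elim by (simp add: divide_right_mono)
  qed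
  show ?thesis
    by (rule tendsto_le[OF _ lim2 lim1 ev]) simp
qed

text \<open>The solution \<open>x\<close> is the Laplace transform at \<open>l\<close> of the orbit
  of \<open>y\<close>, built as the limit of the integrals \<open>J n\<close> over
  \<open>[0, n]\<close>. These converge because the rescaled orbit decays exponentially.\<close>

lemma generator_resolvent_surj:
  fixes S :: "real \<Rightarrow> 'a::{real_inner,complete_space} \<Rightarrow> 'a"
  assumes S: "strongly_continuous_semigroup S"
    and bd: "\<And>t x. 0 \<le> t \<Longrightarrow> norm (S t x) \<le> C * exp (w * t) * norm x"
    and wl: "w < l" and C: "C \<ge> 0"
  shows "\<exists>x. ((\<lambda>h. (S h x - x) /\<^sub>R h) \<longlongrightarrow> l *\<^sub>R x - y) (at_right 0)"
proof -
  define R where "R t z = exp (- l * t) *\<^sub>R S t z" for t z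
  have lin: "bounded_linear (S t)" if "t \<ge> 0" for t
    using S that by (auto simp: strongly_continuous_semigroup_def)
  have add: "S (s + t) z = S s (S t z)" if "s \<ge> 0" "t \<ge> 0" for s t z
    using S that by (auto simp: strongly_continuous_semigroup_def)
  have S0: "S 0 z = z" for z
    using S by (auto simp: strongly_continuous_semigroup_def)
  have Rlin: "bounded_linear (R t)" if "t \<ge> 0" for t
    unfolding R_def by (intro bounded_linear_intros lin that)
  have Radd: "R (s + t) z = R s (R t z)" if "s \<ge> 0" "t \<ge> 0" for s t z
    using that by (simp add: R_def add linear_simps[OF lin] exp_add algebra_simps flip: exp_add)
  have Rbd: "norm (R t z) \<le> C * exp (- (l - w) * t) * norm z" if "t \<ge> 0" for t z
  proof -
    have "norm (R t z) = exp (- l * t) * norm (S t z)" by (simp add: R_def)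
    also have "\<dots> \<le> exp (- l * t) * (C * exp (w * t) * norm z)"
      using bd[OF that] by (intro mult_left_mono) auto
    also have "\<dots> = C * exp (- (l - w) * t) * norm z"
      by (simp add: algebra_simps flip: exp_add)
    finally show ?thesis .
  qed
  have cont: "continuous_on {0..} (\<lambda>t. R t z)" for z
    unfolding R_def using S by (auto intro!: continuous_intros simp: strongly_continuous_semigroup_def)
  have contab: "continuous_on {a..b} (\<lambda>t. R t z)" if "a \<ge> 0" for a b z
    by (rule continuous_on_subset[OF cont]) (use that in auto)
  define J where "J a = integral {0..a} (\<lambda>t. R t y)" for a
  have int: "(\<lambda>t. R t y) integrable_on {a..b}" if "a \<ge> 0" for a b
    by (rule hilbert_integrable_continuous[OF contab[OF that]])
  have Jdiff: "J b - J a = integral {a..b} (\<lambda>t. R t y)" if "0 \<le> a" "a \<le> b" for a b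
    using hilbert_integral_combine[OF contab[OF order_refl], of a b y] that by (simp add: J_def algebra_simps)
  let ?c = "l - w"
  have expderiv: "((\<lambda>t. - C * exp (- c * t) / c * norm y) has_vector_derivative C * exp (- c * t) * norm y) (at t within X)"
    if "c \<noteq> 0" for c t X
    unfolding has_real_derivative_iff_has_vector_derivative[symmetric]
    by (rule derivative_eq_intros refl | use that in \<open>simp\<close>)+
  have expint: "((\<lambda>t. C * exp (- ?c * t) * norm y) has_integral
      (- C * exp (- ?c * b) / ?c * norm y) - (- C * exp (- ?c * a) / ?c * norm y)) {a..b}" if "a \<le> b" for a b
    by (rule fundamental_theorem_of_calculus)
      (use that wl expderiv[of ?c] in auto)
  have Jcauchy: "norm (J b - J a) \<le> C * exp (- ?c * a) / ?c * norm y" if "0 \<le> a" "a \<le> b" for a b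
  proof -
    have "norm (J b - J a) \<le> integral {a..b} (\<lambda>t. C * exp (- ?c * t) * norm y)"
      unfolding Jdiff[OF that]
      by (rule norm_integral_le_dominated) (use that expint[OF that(2)] Rbd in \<open>auto intro!: int\<close>)
    also have "\<dots> = (- C * exp (- ?c * b) / ?c * norm y) - (- C * exp (- ?c * a) / ?c * norm y)"
      by (rule integral_unique[OF expint[OF that(2)]])
    also have "\<dots> \<le> C * exp (- ?c * a) / ?c * norm y"
      using wl C by simp
    finally show ?thesis .
  qed
  have lim0: "(\<lambda>n. C * exp (- ?c * real n) / ?c * norm y) \<longlonglongrightarrow> 0"
  proof -
    have "(\<lambda>n. exp (- ?c * real n)) \<longlonglongrightarrow> 0"
      using wl by real_asymp
    from tendsto_mult_right[OF this, of "C / ?c * norm y"] show ?thesis by (simp add: algebra_simps)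
  qed
  have "Cauchy (\<lambda>n. J (real n))"
  proof (rule metric_CauchyI)
    fix e :: real assume "e > 0"
    then obtain N where N: "C * exp (- ?c * real n) / ?c * norm y < e" if "n \<ge> N" for n
      using order_tendstoD(2)[OF lim0] by (auto simp: eventually_sequentially)
    show "\<exists>N. \<forall>m\<ge>N. \<forall>n\<ge>N. dist (J (real m)) (J (real n)) < e"
    proof (intro exI allI impI)
      fix m n assume mn: "N \<le> m" "N \<le> n"
      show "dist (J (real m)) (J (real n)) < e"
      proof (cases "m \<le> n")
        case True
        then show ?thesis using Jcauchy[of "real m" "real n"] N[OF mn(1)]
          by (simp add: dist_norm norm_minus_commute)
      next
        case False
        then show ?thesis using Jcauchy[of "real n" "real m"] N[OF mn(2)]
          by (simp add: dist_norm)
      qed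
    qed
  qed
  then obtain x where x: "(\<lambda>n. J (real n)) \<longlonglongrightarrow> x"
    using Cauchy_convergent convergent_def by blast
  \<comment> \<open>By the semigroup law, \<open>R h\<close> moves the window of integration from
    \<open>[0, a]\<close> to \<open>[h, a + h]\<close>. Letting \<open>a\<close> tend to infinity
    gives \<open>Rx\<close>.\<close>
  have shift: "R h (J a) = J (a + h) - J h" if "h \<ge> 0" "a \<ge> 0" for h a
  proof -
    have "((R h \<circ> (\<lambda>t. R t y)) has_integral R h (J a)) {0..a}"
      unfolding J_def by (rule has_integral_linear[OF integrable_integral[OF int] Rlin]) (use that in auto)
    moreover have "(((\<lambda>t. R t y) \<circ> ((+) h)) has_integral (J (a + h) - J h)) {0..a}"
      using has_integral_shift_cbox_iff[of "\<lambda>t. R t y" h _ 0 a] that int[of h "a + h"] Jdiff[of h "a + h"]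
      by (auto simp: add.commute)
    then have "((R h \<circ> (\<lambda>t. R t y)) has_integral (J (a + h) - J h)) {0..a}"
      by (rule has_integral_eq[rotated]) (use that in \<open>simp add: Radd\<close>)
    ultimately show ?thesis by (rule has_integral_unique)
  qed
  have Rx: "R h x = x - J h" if h: "h \<ge> 0" for h
  proof -
    have 1: "(\<lambda>n. R h (J (real n))) \<longlonglongrightarrow> R h x"
      by (rule bounded_linear.tendsto[OF Rlin[OF h] x])
    have "(\<lambda>n. J (real n + h) - J (real n)) \<longlonglongrightarrow> 0"
      by (rule Lim_null_comparison[OF _ lim0]) (use h Jcauchy in auto)
    from tendsto_add[OF this x] have "(\<lambda>n. J (real n + h)) \<longlonglongrightarrow> x" by simp
    then have "(\<lambda>n. J (real n + h) - J h) \<longlonglongrightarrow> x - J h" by (intro tendsto_intros)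
    then have "(\<lambda>n. R h (J (real n))) \<longlonglongrightarrow> x - J h" using h by (simp add: shift)
    with 1 show ?thesis by (rule LIMSEQ_unique)
  qed
  have Jlim: "((\<lambda>h. J h /\<^sub>R h) \<longlongrightarrow> y) (at_right 0)"
  proof (rule tendstoI)
    fix e :: real assume e: "e > 0"
    have "continuous (at 0 within {0..}) (\<lambda>t. R t y)"
      using cont[of y] by (auto simp: continuous_on_eq_continuous_within)
    then have "((\<lambda>t. R t y) \<longlongrightarrow> y) (at 0 within {0..})"
      by (simp add: continuous_within R_def S0)
    from tendstoD[OF this, of "e / 2"] e obtain d where d0: "d > 0"
        "\<And>t. t \<in> {0..} \<Longrightarrow> t \<noteq> 0 \<Longrightarrow> dist t 0 < d \<Longrightarrow> dist (R t y) y < e / 2"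
      unfolding eventually_at by auto
    have d: "norm (R t y - y) < e / 2" if "0 \<le> t" "t < d" for t
    proof (cases "t = 0")
      case True
      then show ?thesis using e by (simp add: R_def S0)
    next
      case False
      then show ?thesis using d0(2)[of t] that by (simp add: dist_norm)
    qed
    have "norm (J h /\<^sub>R h - y) < e" if h: "0 < h" "h < d" for h
    proof -
      have "((\<lambda>t. R t y - y) has_integral (J h - h *\<^sub>R y)) {0..h}"
        unfolding J_def using has_integral_diff[OF integrable_integral[OF int[of 0 h]] has_integral_const_real[of y 0 h]] h by simp
      then have "norm (J h - h *\<^sub>R y) \<le> e / 2 * measure lborel {0..h}"
        by (rule has_integral_bound_real[where S="{}", rotated 2]) (use e less_imp_le[OF d] h in auto)
      then have "norm (J h - h *\<^sub>R y) \<le> e / 2 * h" using h by simp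
      moreover have "J h /\<^sub>R h - y = (J h - h *\<^sub>R y) /\<^sub>R h" using h by (simp add: algebra_simps)
      ultimately have "norm (J h /\<^sub>R h - y) \<le> e / 2" using h by (simp add: pos_divide_le_eq flip: divide_inverse_commute)
      then show ?thesis using e by simp
    qed
    then show "\<forall>\<^sub>F h in at_right 0. dist (J h /\<^sub>R h) y < e"
      unfolding eventually_at_right_field dist_norm using d0(1) by auto
  qed
  \<comment> \<open>Undoing the rescaling in \<open>Rx\<close> gives
    \<open>S h x = exp (l * h) (x - J h)\<close>; the expression is its difference quotient.\<close>
  have "((\<lambda>h. ((exp (l * h) - 1) / h) *\<^sub>R x - exp (l * h) *\<^sub>R (J h /\<^sub>R h)) \<longlongrightarrow> l *\<^sub>R x - 1 *\<^sub>R y) (at_right 0)"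
  proof (intro tendsto_diff tendsto_scaleR tendsto_const Jlim)
    show "((\<lambda>h. (exp (l * h) - 1) / h) \<longlongrightarrow> l) (at_right 0)" by real_asymp
    show "((\<lambda>h. exp (l * h)) \<longlongrightarrow> 1) (at_right 0)" by real_asymp
  qed
  then have "((\<lambda>h. (S h x - x) /\<^sub>R h) \<longlongrightarrow> l *\<^sub>R x - 1 *\<^sub>R y) (at_right 0)"
  proof (rule Lim_transform_eventually)
    show "\<forall>\<^sub>F h in at_right 0. ((exp (l * h) - 1) / h) *\<^sub>R x - exp (l * h) *\<^sub>R (J h /\<^sub>R h) = (S h x - x) /\<^sub>R h"
      using eventually_at_right_less[of 0]
    proof eventually_elim
      case (elim h)
      have "S h x = exp (l * h) *\<^sub>R R h x" by (simp add: R_def flip: exp_add)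
      also have "\<dots> = exp (l * h) *\<^sub>R (x - J h)" using elim by (simp add: Rx)
      finally have "S h x = exp (l * h) *\<^sub>R (x - J h)" .
      then show ?case by (simp only:) (simp add: divide_inverse algebra_simps)
    qed
  qed
  then show ?thesis by auto
qed

text \<open>Existence and uniqueness first make the definite description in \<open>resolvent\<close>
  meaningful, so that the estimate can be applied to its value.\<close>

lemma norm_resolvent_le:
  fixes S :: "real \<Rightarrow> 'a::{real_inner,complete_space} \<Rightarrow> 'a"
  assumes S: "strongly_continuous_semigroup S" and gen: "is_generator S D A"
    and bd: "\<And>t x. 0 \<le> t \<Longrightarrow> norm (S t x) \<le> C * exp (w * t) * norm x"
    and wl: "w < l" and C: "C \<ge> 0"
  shows "norm (resolvent D A l y) \<le> C / (l - w) * norm y"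
proof -
  have D: "x \<in> D \<and> A x = a \<longleftrightarrow> ((\<lambda>h. (S h x - x) /\<^sub>R h) \<longlongrightarrow> a) (at_right 0)" for x a
  proof
    assume "x \<in> D \<and> A x = a"
    then show "((\<lambda>h. (S h x - x) /\<^sub>R h) \<longlongrightarrow> a) (at_right 0)"
      using gen by (auto simp: is_generator_def)
  next
    assume a: "((\<lambda>h. (S h x - x) /\<^sub>R h) \<longlongrightarrow> a) (at_right 0)"
    then have "x \<in> D" using gen by (auto simp: is_generator_def)
    moreover from this have "((\<lambda>h. (S h x - x) /\<^sub>R h) \<longlongrightarrow> A x) (at_right 0)"
      using gen by (auto simp: is_generator_def)
    from tendsto_unique[OF _ this a] have "A x = a" by simp
    ultimately show "x \<in> D \<and> A x = a" by simp
  qed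
  obtain x where x: "((\<lambda>h. (S h x - x) /\<^sub>R h) \<longlongrightarrow> l *\<^sub>R x - y) (at_right 0)"
    using generator_resolvent_surj[OF S bd wl C] by blast
  then have xD: "x \<in> D \<and> l *\<^sub>R x - A x = y" using D[of x "l *\<^sub>R x - y"] by simp
  have uniq: "z = x" if z: "z \<in> D \<and> l *\<^sub>R z - A z = y" for z
  proof -
    have "((\<lambda>h. (S h z - z) /\<^sub>R h - (S h x - x) /\<^sub>R h) \<longlongrightarrow> (l *\<^sub>R z - y) - (l *\<^sub>R x - y)) (at_right 0)"
      using D[of z "l *\<^sub>R z - y"] z x by (intro tendsto_diff) (auto simp: algebra_simps)
    \<comment> \<open>For the difference of two solutions the derivative at 0 is
      \<open>l (z - x)\<close>, so the right side of the estimate vanishes.\<close>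
    then have "((\<lambda>h. (S h (z - x) - (z - x)) /\<^sub>R h) \<longlongrightarrow> l *\<^sub>R (z - x)) (at_right 0)"
    proof (rule Lim_transform_eventually[THEN tendsto_eq_rhs])
      show "\<forall>\<^sub>F h in at_right 0. (S h z - z) /\<^sub>R h - (S h x - x) /\<^sub>R h = (S h (z - x) - (z - x)) /\<^sub>R h"
        using eventually_at_right_less[of 0]
      proof eventually_elim
        case (elim h)
        have "bounded_linear (S h)" using S elim by (simp add: strongly_continuous_semigroup_def)
        then have "S h (z - x) = S h z - S h x" by (simp add: linear_simps)
        then show ?case by (simp add: scaleR_diff_right)
      qed
    qed (simp add: algebra_simps)
    from semigroup_norm_resolvent_le[OF S bd wl this] show "z = x"
      using wl by (simp add: mult_le_0_iff)
  qed
  have "resolvent D A l y = x"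
    unfolding resolvent_def by (rule the_equality, rule xD, rule uniq)
  moreover have "(l - w) * norm x \<le> C * norm y"
    using semigroup_norm_resolvent_le[OF S bd wl x] by simp
  ultimately show ?thesis using wl by (simp add: field_simps)
qed

text \<open>The resolvent at \<open>l + s\<close> has norm at most \<open>C / (l + s - w)\<close>.
  Hence the integrand in Balakrishnan's formula is integrable near 0 because \<open>g < 1\<close>,
  and at infinity because \<open>g > 0\<close>; the case \<open>g = 0\<close> is the
  identity.\<close>

lemma neg_frac_power_bound:
  fixes S :: "real \<Rightarrow> 'a::{real_inner,complete_space} \<Rightarrow> 'a"
  assumes S: "strongly_continuous_semigroup S" and gen: "is_generator S D A"
    and l: "exceeds_growth_bound S l" and g: "0 \<le> g" "g < 1"
  shows "\<exists>K\<ge>0. \<forall>x. norm (neg_frac_power D A l g x) \<le> K * norm x"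
proof (cases "g = 0")
  case True
  then show ?thesis by (intro exI[of _ 1]) (simp add: neg_frac_power_def)
next
  case False
  obtain C0 w where w: "w < l" and bd0: "\<And>t x. t \<ge> 0 \<Longrightarrow> norm (S t x) \<le> C0 * exp (w * t) * norm x"
    using l by (auto simp: exceeds_growth_bound_def)
  define C where "C = \<bar>C0\<bar>"
  have C: "C \<ge> 0" by (simp add: C_def)
  have bd: "norm (S t x) \<le> C * exp (w * t) * norm x" if "t \<ge> 0" for t x
    by (rule order_trans[OF bd0[OF that]]) (auto simp: C_def intro!: mult_right_mono)
  \<comment> \<open>On \<open>[0, 1]\<close> the factor \<open>1 / (l + s - w)\<close> is at most
    \<open>1 / (l - w)\<close>, and beyond 1 at most \<open>1 / s\<close>. Both pieces count at
    \<open>s = 1\<close>, which is harmless for an upper bound.\<close>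
  define G where "G s = (if s \<in> {0..1} then s powr (- g) else 0) * (1 / (l - w))
      + (if s \<in> {1..} then s powr (- g - 1) else 0)" for s :: real
  have G: "G integrable_on {0<..}"
    unfolding G_def
  proof (intro integrable_add integrable_on_mult_left)
    have "(\<lambda>s. s powr (- g)) integrable_on {0..1::real}"
      by (rule integrable_on_powr_from_0) (use g in auto)
    then have "(\<lambda>s. if s \<in> {0..1} then s powr (- g) else 0) integrable_on (UNIV :: real set)"
      by (simp only: integrable_restrict_UNIV)
    also have "(\<lambda>s. if s \<in> {0..1} then s powr (- g) else 0)
        = (\<lambda>s::real. if s \<in> {0<..} then (if s \<in> {0..1} then s powr (- g) else 0) else 0)"
      by (rule ext) (auto simp: less_eq_real_def)
    finally show "(\<lambda>s::real. if s \<in> {0..1} then s powr (- g) else 0) integrable_on {0<..}"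
      by (simp only: integrable_restrict_UNIV)
    have "(\<lambda>s. s powr (- g - 1)) integrable_on {1::real..}"
      using has_integral_powr_to_inf[of "- g - 1" 1] g False by (simp add: has_integral_integrable)
    moreover have "{1..} \<inter> {0<..} = {1::real..}" by auto
    ultimately show "(\<lambda>s::real. if s \<in> {1..} then s powr (- g - 1) else 0) integrable_on {0<..}"
      unfolding integrable_restrict_Int by simp
  qed
  have Gle: "s powr (- g) * (1 / (l + s - w)) \<le> G s" if s: "s > 0" for s
  proof (cases "s \<le> 1")
    case True
    have "s powr (- g) * (1 / (l + s - w)) \<le> s powr (- g) * (1 / (l - w))"
      using s w by (intro mult_left_mono divide_left_mono) auto
    then show ?thesis using True s by (auto simp: G_def)
  next
    case False
    have "s powr (- g) * (1 / (l + s - w)) \<le> s powr (- g) * (1 / s)"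
      using s w by (intro mult_left_mono divide_left_mono) auto
    also have "\<dots> = s powr (- g - 1)" using s by (simp add: powr_diff)
    finally show ?thesis using False by (simp add: G_def)
  qed
  have "norm (neg_frac_power D A l g x) \<le> (\<bar>sin (pi * g) / pi\<bar> * (C * integral {0<..} G)) * norm x" for x
  proof -
    let ?f = "\<lambda>s. (s powr (- g)) *\<^sub>R resolvent D A (l + s) x"
    have "norm (integral {0<..} ?f) \<le> C * integral {0<..} G * norm x"
    proof (cases "?f integrable_on {0<..}")
      case True
      have "norm (integral {0<..} ?f) \<le> integral {0<..} (\<lambda>s. (C * norm x) * G s)"
      proof (rule norm_integral_le_dominated[OF True])
        show "(\<lambda>s. C * norm x * G s) integrable_on {0<..}" by (rule integrable_on_mult_right[OF G])
        fix s :: real assume "s \<in> {0<..}"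
        then have s: "s > 0" by simp
        have "norm (?f s) \<le> s powr (- g) * (C / (l + s - w) * norm x)"
          using mult_left_mono[OF norm_resolvent_le[OF S gen bd, of "l + s" x], of "s powr (- g)"] s w C by simp
        also have "\<dots> = C * norm x * (s powr (- g) * (1 / (l + s - w)))" by simp
        also have "\<dots> \<le> C * norm x * G s" by (intro mult_left_mono Gle s) (simp add: C)
        finally show "norm (?f s) \<le> C * norm x * G s" .
      qed
      then show ?thesis by (simp add: algebra_simps)
    next
      \<comment> \<open>The gauge integral then has the default value 0.\<close>
      case False
      have "0 \<le> integral {0<..} G" by (rule integral_nonneg[OF G]) (use w in \<open>auto simp: G_def\<close>)
      then show ?thesis using False C by (simp add: not_integrable_integral)
    qed
    then have "\<bar>sin (pi * g) / pi\<bar> * norm (integral {0<..} ?f) \<le> \<bar>sin (pi * g) / pi\<bar> * (C * integral {0<..} G * norm x)"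
      by (intro mult_left_mono) auto
    then show ?thesis using False by (simp add: neg_frac_power_def mult.assoc)
  qed
  moreover have "0 \<le> \<bar>sin (pi * g) / pi\<bar> * (C * integral {0<..} G)"
    using C w by (intro mult_nonneg_nonneg integral_nonneg[OF G]) (auto simp: G_def)
  ultimately show ?thesis by blast
qed

text \<open>\<open>is_completion\<close> prescribes the norm of \<open>j x\<close> by the fractional
  power, so the bound on the latter is exactly continuity of \<open>j\<close>. It lets limits and
  integrals in the Hilbert space be carried to the extrapolation space.\<close>

lemma extrapolation_embedding_bounded_linear:
  fixes S :: "real \<Rightarrow> 'a::{real_inner,complete_space} \<Rightarrow> 'a" and j :: "'a \<Rightarrow> 'e::banach"
  assumes "strongly_continuous_semigroup S" "is_generator S D A"
    "exceeds_growth_bound S l" "0 \<le> g" "g < 1" and j: "extrapolation_space D A l g j"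
  shows "bounded_linear j"
proof -
  obtain K where K: "\<And>x. norm (neg_frac_power D A l g x) \<le> K * norm x"
    using neg_frac_power_bound[OF assms(1-5)] by blast
  have "linear j" "\<And>x. norm (j x) = norm (neg_frac_power D A l g x)"
    using j by (auto simp: extrapolation_space_def is_completion_def)
  then show ?thesis
    using K by (intro bounded_linear.intro bounded_linear_axioms.intro) (auto simp: mult.commute intro!: exI[of _ K])
qed

section \<open>Moments of the Poisson distribution\<close>

text \<open>All moments follow from the recursion \<open>(n + 1) * p (n + 1) = a * p n\<close>. Used
  twice it gives the factorial moment \<open>a * a\<close>, to which the mean is added. The index
  shift costs nothing because the terms at 0 vanish.\<close>

lemma sums_poisson:
  fixes a :: real
  defines "p \<equiv> \<lambda>n. a ^ n / fact n * exp (- a)"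
  shows "p sums 1" "(\<lambda>n. real n * p n) sums a" "(\<lambda>n. (real n)\<^sup>2 * p n) sums (a\<^sup>2 + a)"
proof -
  have "(\<lambda>n. inverse (fact n) *\<^sub>R a ^ n * exp (- a)) sums (exp a * exp (- a))"
    by (intro sums_mult2) (rule exp_converges)
  then show 0: "p sums 1"
    by (simp add: p_def divide_inverse mult.commute mult.left_commute flip: exp_add)
  have step: "real (Suc n) * p (Suc n) = a * p n" for n
  proof -
    have "fact (Suc n) = real (Suc n) * fact n" by simp
    then show ?thesis unfolding p_def by (simp del: fact_Suc of_nat_Suc)
  qed
  have "(\<lambda>n. real (Suc n) * p (Suc n)) sums a"
    unfolding step using sums_mult[OF 0, of a] by simp
  from sums_Suc[OF this] show 1: "(\<lambda>n. real n * p n) sums a" by simp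
  have "(\<lambda>n. real n * (real (Suc n) * p (Suc n))) sums (a * a)"
    unfolding step using sums_mult[OF 1, of a] by (simp add: mult.left_commute)
  then have "(\<lambda>n. (real (Suc n) - 1) * (real (Suc n) * p (Suc n))) sums (a * a)" by simp
  from sums_Suc[OF this] have "(\<lambda>n. (real n - 1) * (real n * p n)) sums (a * a)" by simp
  from sums_add[OF this 1] show "(\<lambda>n. (real n)\<^sup>2 * p n) sums (a\<^sup>2 + a)"
    by (simp add: power2_eq_square algebra_simps)
qed

section \<open>Simple integrands against a Poisson random measure\<close>

text \<open>The level sets are padded by empty sets to a sequence, the form in which independence of
  the Poisson random measure is stated. One representation serves every measure on the same sets,
  hence both \<open>\<eta> \<omega>\<close> and the compensator. The level set of the value 0 may
  have infinite measure.\<close>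

lemma simple_bochner_integral_finite_partition:
  fixes f :: "'p \<Rightarrow> 'a::real_vector"
  assumes f: "Bochner_Integration.simple_bochner_integrable C f"
  obtains k :: nat and A :: "nat \<Rightarrow> 'p set" and c :: "nat \<Rightarrow> 'a"
  where "disjoint_family A" "range A \<subseteq> sets C" "(\<Union>i<k. A i) = space C"
    "\<And>i p. i < k \<Longrightarrow> p \<in> A i \<Longrightarrow> f p = c i"
    "\<And>i. i < k \<Longrightarrow> c i \<noteq> 0 \<Longrightarrow> emeasure C (A i) < \<infinity>"
    "\<And>N. sets N = sets C \<Longrightarrow> Bochner_Integration.simple_bochner_integral N f = (\<Sum>i<k. measure N (A i) *\<^sub>R c i)"
proof -
  have sf: "simple_function C f" and fin: "emeasure C {p\<in>space C. f p \<noteq> 0} \<noteq> \<infinity>"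
    using f by (auto elim: simple_bochner_integrable.cases)
  obtain c where c: "bij_betw c {..<card (f ` space C)} (f ` space C)"
    using ex_bij_betw_nat_finite[OF simple_functionD(1)[OF sf]] by (auto simp: atLeast0LessThan)
  define k where "k = card (f ` space C)"
  define A where "A i = (if i < k then {p\<in>space C. f p = c i} else {})" for i
  have cinj: "inj_on c {..<k}" and cim: "c ` {..<k} = f ` space C"
    using c by (auto simp: k_def bij_betw_def)
  have Aset: "A i \<in> sets C" for i
  proof -
    have "f -` {c i} \<inter> space C = {p\<in>space C. f p = c i}" by auto
    then show ?thesis using simple_functionD(2)[OF sf, of "{c i}"] by (simp add: A_def)
  qed
  show ?thesis
  proof (rule that[of A k c])
    show "disjoint_family A"
      using cinj by (auto simp: disjoint_family_on_def A_def inj_on_def)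
    show "range A \<subseteq> sets C" using Aset by auto
    show "(\<Union>i<k. A i) = space C"
    proof (intro equalityI subsetI)
      fix p assume p: "p \<in> space C"
      then have "f p \<in> c ` {..<k}" using cim by auto
      then obtain i where "i < k" "f p = c i" by auto
      then show "p \<in> (\<Union>i<k. A i)" using p by (auto simp: A_def)
    qed (auto simp: A_def)
    show "f p = c i" if "i < k" "p \<in> A i" for i p using that by (auto simp: A_def)
    show "emeasure C (A i) < \<infinity>" if "i < k" "c i \<noteq> 0" for i
    proof -
      have "emeasure C (A i) \<le> emeasure C {p\<in>space C. f p \<noteq> 0}"
        using that simple_functionD(2)[OF sf, of "- {0}"]
        by (intro emeasure_mono) (auto simp: A_def vimage_def Int_def conj_commute)
      then show ?thesis using fin by (simp add: top.not_eq_extremum order_le_less_trans)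
    qed
    fix N :: "'p measure" assume N: "sets N = sets C"
    then have sp: "space N = space C" by (rule sets_eq_imp_space_eq)
    have "Bochner_Integration.simple_bochner_integral N f
        = (\<Sum>y\<in>c ` {..<k}. measure N {p\<in>space C. f p = y} *\<^sub>R y)"
      by (simp add: simple_bochner_integral_def sp cim)
    also have "\<dots> = (\<Sum>i<k. measure N {p\<in>space C. f p = c i} *\<^sub>R c i)"
      by (rule sum.reindex_cong[OF cinj refl refl])
    also have "\<dots> = (\<Sum>i<k. measure N (A i) *\<^sub>R c i)"
      by (rule sum.cong) (auto simp: A_def)
    finally show "Bochner_Integration.simple_bochner_integral N f = (\<Sum>i<k. measure N (A i) *\<^sub>R c i)" .
  qed
qed

text \<open>The norm is expanded into inner products because sums of Borel functions
  need not be Borel in a nonseparable space.\<close>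

lemma borel_measurable_norm_sum_diff:
  fixes X :: "'w \<Rightarrow> 'a::real_inner"
  assumes t: "\<And>i. i < k \<Longrightarrow> t i \<in> borel_measurable M" and X: "X \<in> borel_measurable M"
  shows "(\<lambda>\<omega>. norm ((\<Sum>i<k. t i \<omega> *\<^sub>R c i) - X \<omega>)) \<in> borel_measurable M"
proof -
  have Xc: "(\<lambda>\<omega>. X \<omega> \<bullet> v) \<in> borel_measurable M" for v
    by (rule measurable_compose[OF X]) (intro borel_measurable_continuous_onI continuous_intros)
  have XX: "(\<lambda>\<omega>. X \<omega> \<bullet> X \<omega>) \<in> borel_measurable M"
    by (rule measurable_compose[OF X]) (intro borel_measurable_continuous_onI continuous_intros)
  let ?a = "\<lambda>\<omega>. \<Sum>i<k. t i \<omega> *\<^sub>R c i"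
  have a: "?a \<omega> \<bullet> v = (\<Sum>i<k. t i \<omega> * (v \<bullet> c i))" for \<omega> v
    by (subst inner_commute) (simp add: inner_sum_right)
  have n1: "norm (?a \<omega> - X \<omega>) = sqrt (?a \<omega> \<bullet> ?a \<omega> - 2 * (?a \<omega> \<bullet> X \<omega>) + X \<omega> \<bullet> X \<omega>)" for \<omega>
    by (simp only: norm_eq_sqrt_inner inner_diff_left inner_diff_right inner_commute[of "X \<omega>" "?a \<omega>"]) simp
  have n2: "?a \<omega> \<bullet> ?a \<omega> = (\<Sum>i<k. t i \<omega> * (\<Sum>l<k. t l \<omega> * (c i \<bullet> c l)))" for \<omega>
    by (subst a) (simp only: a)
  have "norm (?a \<omega> - X \<omega>) = sqrt ((\<Sum>i<k. t i \<omega> * (\<Sum>l<k. t l \<omega> * (c i \<bullet> c l)))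
      - 2 * (\<Sum>i<k. t i \<omega> * (X \<omega> \<bullet> c i)) + X \<omega> \<bullet> X \<omega>)" for \<omega>
    unfolding n1 n2 by (simp only: a)
  then show ?thesis
    using t Xc XX by simp
qed

section \<open>Law, moments and independence of the jump counts\<close>

locale poisson_random = prob_space M for M :: "'w measure" +
  fixes F :: "real \<Rightarrow> 'w measure" and \<nu> :: "real measure" and \<eta> :: "'w \<Rightarrow> (real \<times> real) measure"
  assumes prm: "poisson_random_measure M F \<nu> \<eta>"
begin

abbreviation "C \<equiv> compensator \<nu>"

lemma sets_\<eta>: "\<omega> \<in> space M \<Longrightarrow> sets (\<eta> \<omega>) = sets C"
  using prm by (simp add: poisson_random_measure_def)

lemma measurable_emeasure_\<eta> [measurable]: "A \<in> sets C \<Longrightarrow> (\<lambda>\<omega>. emeasure (\<eta> \<omega>) A) \<in> borel_measurable M"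
  using prm by (simp add: poisson_random_measure_def)

lemma measurable_measure_\<eta> [measurable]: "A \<in> sets C \<Longrightarrow> (\<lambda>\<omega>. measure (\<eta> \<omega>) A) \<in> borel_measurable M"
  unfolding measure_def by measurable

lemma prob_\<eta>_eq:
  assumes "A \<in> sets C" "emeasure C A < \<infinity>"
  shows "prob {\<omega>\<in>space M. emeasure (\<eta> \<omega>) A = of_nat n} = measure C A ^ n / fact n * exp (- measure C A)"
  using prm assms by (simp add: poisson_random_measure_def)

lemma indep_vars_\<eta>:
  assumes "range A \<subseteq> sets C" "disjoint_family A"
  shows "indep_vars (\<lambda>_. borel) (\<lambda>n \<omega>. emeasure (\<eta> \<omega>) (A n)) (UNIV :: nat set)"
  using prm assms by (simp add: poisson_random_measure_def)

text \<open>The Poisson weights sum to 1, which leaves no mass for an infinite count.\<close>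

lemma AE_\<eta>_nat:
  assumes A: "A \<in> sets C" "emeasure C A < \<infinity>"
  shows "AE \<omega> in M. \<exists>n. emeasure (\<eta> \<omega>) A = of_nat n"
proof -
  let ?E = "\<lambda>n. {\<omega>\<in>space M. emeasure (\<eta> \<omega>) A = of_nat n}"
  have E: "?E n \<in> sets M" for n using A(1) by measurable
  have "(\<lambda>n. prob (?E n)) sums prob (\<Union>n. ?E n)"
    by (rule finite_measure_UNION) (use E in \<open>auto simp: disjoint_family_on_def\<close>)
  moreover have "(\<lambda>n. prob (?E n)) sums 1"
    unfolding prob_\<eta>_eq[OF A] by (rule sums_poisson)
  ultimately have "prob (\<Union>n. ?E n) = 1" by (rule sums_unique2)
  then have "AE \<omega> in M. \<omega> \<in> (\<Union>n. ?E n)"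
    by (subst AE_in_set_eq_1) (use E in auto)
  then show ?thesis by eventually_elim auto
qed

lemma AE_\<eta>_finite:
  assumes A: "A \<in> sets C" "emeasure C A < \<infinity>"
  shows "AE \<omega> in M. emeasure (\<eta> \<omega>) A < \<infinity>"
  using AE_\<eta>_nat[OF A] by eventually_elim (auto simp: of_nat_less_top)

text \<open>With \<open>a\<close> the intensity, the probability is
  \<open>1 - exp (- a)\<close>.\<close>

lemma prob_\<eta>_nonzero_le:
  assumes A: "A \<in> sets C" "emeasure C A < \<infinity>"
  shows "prob {\<omega>\<in>space M. emeasure (\<eta> \<omega>) A \<noteq> 0} \<le> measure C A"
proof -
  have E0: "{\<omega>\<in>space M. emeasure (\<eta> \<omega>) A = of_nat 0} \<in> sets M"
    using A(1) by measurable
  have "{\<omega>\<in>space M. emeasure (\<eta> \<omega>) A \<noteq> 0} = space M - {\<omega>\<in>space M. emeasure (\<eta> \<omega>) A = of_nat 0}"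
    by auto
  then have "prob {\<omega>\<in>space M. emeasure (\<eta> \<omega>) A \<noteq> 0} = 1 - prob {\<omega>\<in>space M. emeasure (\<eta> \<omega>) A = of_nat 0}"
    by (simp only:) (rule prob_compl, rule E0)
  also have "\<dots> = 1 - exp (- measure C A)" by (subst prob_\<eta>_eq[OF A]) simp
  also have "\<dots> \<le> measure C A" using exp_ge_add_one_self[of "- measure C A"] by simp
  finally show ?thesis .
qed

lemma nn_integral_\<eta>:
  assumes A: "A \<in> sets C" "emeasure C A < \<infinity>" and g: "\<And>n. 0 \<le> g (real n)"
    and s: "(\<lambda>n. g (real n) * (measure C A ^ n / fact n * exp (- measure C A))) sums r"
  shows "(\<integral>\<^sup>+\<omega>. ennreal (g (measure (\<eta> \<omega>) A)) \<partial>M) = ennreal r"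
proof -
  let ?E = "\<lambda>n. {\<omega>\<in>space M. emeasure (\<eta> \<omega>) A = of_nat n}"
  have E [measurable]: "?E n \<in> sets M" for n using A(1) by measurable
  have "(\<integral>\<^sup>+\<omega>. ennreal (g (measure (\<eta> \<omega>) A)) \<partial>M)
      = (\<integral>\<^sup>+\<omega>. (\<Sum>n. ennreal (g (real n)) * indicator (?E n) \<omega>) \<partial>M)"
  proof (rule nn_integral_cong_AE)
    show "AE \<omega> in M. ennreal (g (measure (\<eta> \<omega>) A)) = (\<Sum>n. ennreal (g (real n)) * indicator (?E n) \<omega>)"
      using AE_\<eta>_nat[OF A] AE_space
    proof eventually_elim
      case (elim \<omega>)
      then obtain m where m: "emeasure (\<eta> \<omega>) A = of_nat m" by blast
      then have "measure (\<eta> \<omega>) A = real m" by (simp add: measure_def)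
      moreover have "(\<Sum>n. ennreal (g (real n)) * indicator (?E n) \<omega>) = (\<Sum>n\<in>{m}. ennreal (g (real n)) * indicator (?E n) \<omega>)"
        by (rule suminf_finite) (use m in \<open>auto simp: indicator_def\<close>)
      ultimately show ?case using m elim by (simp add: indicator_def)
    qed
  qed
  also have "\<dots> = (\<Sum>n. ennreal (g (real n)) * emeasure M (?E n))"
    by (subst nn_integral_suminf) (auto simp: nn_integral_cmult_indicator)
  also have "\<dots> = (\<Sum>n. ennreal (g (real n) * (measure C A ^ n / fact n * exp (- measure C A))))"
    by (simp only: emeasure_eq_measure prob_\<eta>_eq[OF A] ennreal_mult'[OF g])
  also have "\<dots> = ennreal r"
    using s g by (intro suminf_ennreal_eq) auto
  finally show ?thesis .
qed

lemma expectation_\<eta>: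
  assumes A: "A \<in> sets C" "emeasure C A < \<infinity>"
  shows "integrable M (\<lambda>\<omega>. measure (\<eta> \<omega>) A)" "expectation (\<lambda>\<omega>. measure (\<eta> \<omega>) A) = measure C A"
    and "integrable M (\<lambda>\<omega>. (measure (\<eta> \<omega>) A)\<^sup>2)"
    and "expectation (\<lambda>\<omega>. (measure (\<eta> \<omega>) A)\<^sup>2) = (measure C A)\<^sup>2 + measure C A"
proof -
  have m [measurable]: "(\<lambda>\<omega>. measure (\<eta> \<omega>) A) \<in> borel_measurable M" by (rule measurable_measure_\<eta>[OF A(1)])
  have 1: "(\<integral>\<^sup>+\<omega>. ennreal (measure (\<eta> \<omega>) A) \<partial>M) = ennreal (measure C A)"
    using nn_integral_\<eta>[OF A, of "\<lambda>x. x", OF _ sums_poisson(2)] by simp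
  have 2: "(\<integral>\<^sup>+\<omega>. ennreal ((measure (\<eta> \<omega>) A)\<^sup>2) \<partial>M) = ennreal ((measure C A)\<^sup>2 + measure C A)"
    using nn_integral_\<eta>[OF A, of "\<lambda>x. x\<^sup>2", OF _ sums_poisson(3)] by simp
  show "integrable M (\<lambda>\<omega>. measure (\<eta> \<omega>) A)" "integrable M (\<lambda>\<omega>. (measure (\<eta> \<omega>) A)\<^sup>2)"
    using 1 2 by (auto intro!: integrableI_nonneg)
  have "expectation (\<lambda>\<omega>. measure (\<eta> \<omega>) A) = enn2real (\<integral>\<^sup>+\<omega>. ennreal (measure (\<eta> \<omega>) A) \<partial>M)"
    by (rule integral_eq_nn_integral) auto
  then show "expectation (\<lambda>\<omega>. measure (\<eta> \<omega>) A) = measure C A" by (simp add: 1)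
  have "expectation (\<lambda>\<omega>. (measure (\<eta> \<omega>) A)\<^sup>2) = enn2real (\<integral>\<^sup>+\<omega>. ennreal ((measure (\<eta> \<omega>) A)\<^sup>2) \<partial>M)"
    by (rule integral_eq_nn_integral) auto
  then show "expectation (\<lambda>\<omega>. (measure (\<eta> \<omega>) A)\<^sup>2) = (measure C A)\<^sup>2 + measure C A"
    unfolding 2 by (simp only: enn2real_ennreal add_nonneg_nonneg zero_le_power2 measure_nonneg)
qed

text \<open>The isometry of the compensated integral on indicators. On the diagonal stands the
  Poisson variance, which equals the intensity; off the diagonal independence factorises the
  expectation and the factors are centred.\<close>

lemma expectation_compensated_product:
  fixes A :: "nat \<Rightarrow> (real \<times> real) set"
  assumes A: "range A \<subseteq> sets C" "disjoint_family A"
    and i: "emeasure C (A i) < \<infinity>" and l: "emeasure C (A l) < \<infinity>"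
  shows "has_bochner_integral M (\<lambda>\<omega>. (measure (\<eta> \<omega>) (A i) - measure C (A i)) * (measure (\<eta> \<omega>) (A l) - measure C (A l)))
    (if i = l then measure C (A i) else 0)"
proof -
  have Ai: "A n \<in> sets C" for n using A(1) by auto
  note ei = expectation_\<eta>[OF Ai i] and el = expectation_\<eta>[OF Ai l]
  show ?thesis
  proof (cases "i = l")
    case True
    have "has_bochner_integral M (\<lambda>\<omega>. (measure (\<eta> \<omega>) (A i))\<^sup>2 - 2 * measure C (A i) * measure (\<eta> \<omega>) (A i) + (measure C (A i))\<^sup>2)
       (((measure C (A i))\<^sup>2 + measure C (A i)) - 2 * measure C (A i) * measure C (A i) + (measure C (A i))\<^sup>2)"
      using ei by (simp add: has_bochner_integral_iff prob_space)
    then show ?thesis using True by (simp add: power2_eq_square algebra_simps)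
  next
    case False
    let ?X = "\<lambda>n \<omega>. measure (\<eta> \<omega>) (A n) - measure C (A n)"
    have "indep_vars (\<lambda>_. borel) (\<lambda>n \<omega>. enn2real (emeasure (\<eta> \<omega>) (A n)) - measure C (A n)) {i, l}"
      by (rule indep_vars_compose2[OF indep_vars_subset[OF indep_vars_\<eta>[OF A]]]) auto
    then have ind: "indep_vars (\<lambda>_. borel) ?X {i, l}" by (simp add: measure_def)
    have int: "integrable M (?X n)" if "n \<in> {i, l}" for n using ei el that by auto
    have ex0: "expectation (?X i) = 0" using ei by (simp add: prob_space)
    have "integrable M (\<lambda>\<omega>. \<Prod>n\<in>{i, l}. ?X n \<omega>)"
      by (rule indep_vars_integrable[OF _ ind int]) auto
    moreover have "expectation (\<lambda>\<omega>. \<Prod>n\<in>{i, l}. ?X n \<omega>) = (\<Prod>n\<in>{i, l}. expectation (?X n))"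
      by (rule indep_vars_lebesgue_integral[OF _ ind int]) auto
    ultimately show ?thesis using False ex0 by (simp add: has_bochner_integral_iff)
  qed
qed

text \<open>Terms with \<open>norm (c i) \<le> 1\<close> are controlled by Chebyshev's inequality; the others
  reduce to their compensator unless one of their sets carries a jump.\<close>

lemma prob_compensated_sum_le:
  fixes c :: "nat \<Rightarrow> 'a::real_inner"
  assumes A: "range A \<subseteq> sets C" "disjoint_family A"
    and fin: "\<And>i. i < k \<Longrightarrow> emeasure C (A i) < \<infinity>"
    and e: "e > 0"
    and r: "(\<Sum>i<k. measure C (A i) * min (norm (c i)) ((norm (c i))\<^sup>2)) \<le> r" "r \<le> e"
  shows "prob {\<omega>\<in>space M. norm (\<Sum>i<k. (measure (\<eta> \<omega>) (A i) - measure C (A i)) *\<^sub>R c i) > 2 * e} \<le> r / e\<^sup>2 + r"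
proof -
  have As: "A n \<in> sets C" for n using A(1) by auto
  define X where "X i \<omega> = measure (\<eta> \<omega>) (A i) - measure C (A i)" for i \<omega>
  have X [measurable]: "X i \<in> borel_measurable M" for i
    unfolding X_def using As by measurable
  let ?w = "\<lambda>i. measure C (A i) * min (norm (c i)) ((norm (c i))\<^sup>2)"
  define I where "I = {i. i < k \<and> norm (c i) \<le> 1}"
  define L where "L = {i. i < k \<and> \<not> norm (c i) \<le> 1}"
  have IL: "{..<k} = I \<union> L" "I \<inter> L = {}" "finite I" "finite L" by (auto simp: I_def L_def)
  have w0: "?w i \<ge> 0" for i by simp
  have wL: "?w i = measure C (A i) * norm (c i)" if "i \<in> L" for i
  proof -
    have "1 \<le> norm (c i)" using that by (simp add: L_def)
    then have "norm (c i) * 1 \<le> norm (c i) * norm (c i)" by (intro mult_left_mono) auto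
    then show ?thesis by (simp add: power2_eq_square min_def)
  qed
  have rI: "(\<Sum>i\<in>I. ?w i) \<le> r" and rL: "(\<Sum>i\<in>L. ?w i) \<le> r"
    by (rule order_trans[OF sum_mono2 r(1)]; use IL w0 in auto)+
  define D1 where "D1 \<omega> = (\<Sum>i\<in>I. X i \<omega> *\<^sub>R c i)" for \<omega>
  define D2 where "D2 \<omega> = (\<Sum>i\<in>L. X i \<omega> *\<^sub>R c i)" for \<omega>
  have D: "(\<Sum>i<k. X i \<omega> *\<^sub>R c i) = D1 \<omega> + D2 \<omega>" for \<omega>
    unfolding D1_def D2_def IL(1) using IL(2-4) by (rule sum.union_disjoint[rotated 2])
  have D1sq: "(norm (D1 \<omega>))\<^sup>2 = (\<Sum>i\<in>I. \<Sum>l\<in>I. (c i \<bullet> c l) * (X i \<omega> * X l \<omega>))" for \<omega>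
    by (simp add: D1_def power2_norm_eq_inner inner_sum_left inner_sum_right sum_distrib_left inner_commute mult_ac)
  \<comment> \<open>Only the diagonal terms survive, and for \<open>norm (c i) \<le> 1\<close> the
    square is the smaller of the two entries in the weight \<open>?w i\<close>.\<close>
  have "has_bochner_integral M (\<lambda>\<omega>. (norm (D1 \<omega>))\<^sup>2) (\<Sum>i\<in>I. \<Sum>l\<in>I. (c i \<bullet> c l) * (if i = l then measure C (A i) else 0))"
    unfolding D1sq X_def
    by (intro has_bochner_integral_sum has_bochner_integral_mult_right expectation_compensated_product A fin) (auto simp: I_def)
  also have "(\<Sum>i\<in>I. \<Sum>l\<in>I. (c i \<bullet> c l) * (if i = l then measure C (A i) else 0)) = (\<Sum>i\<in>I. ?w i)"
  proof (rule sum.cong[OF refl])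
    fix i assume i: "i \<in> I"
    have "(norm (c i))\<^sup>2 \<le> norm (c i)" using i by (simp add: I_def power2_eq_square mult_left_le)
    then show "(\<Sum>l\<in>I. (c i \<bullet> c l) * (if i = l then measure C (A i) else 0)) = ?w i"
      using i IL(3) by (simp add: if_distrib power2_norm_eq_inner cong: if_cong)
  qed
  finally have ED1: "integrable M (\<lambda>\<omega>. (norm (D1 \<omega>))\<^sup>2)" "expectation (\<lambda>\<omega>. (norm (D1 \<omega>))\<^sup>2) \<le> r"
    using rI by (auto simp: has_bochner_integral_iff)
  have mD1: "(\<lambda>\<omega>. norm (D1 \<omega>)) \<in> borel_measurable M"
  proof -
    have "norm (D1 \<omega>) = sqrt (\<Sum>i\<in>I. \<Sum>l\<in>I. (c i \<bullet> c l) * (X i \<omega> * X l \<omega>))" for \<omega>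
      by (simp flip: D1sq)
    then show ?thesis by simp
  qed
  have P1: "prob {\<omega>\<in>space M. norm (D1 \<omega>) \<ge> e} \<le> r / e\<^sup>2"
    using second_moment_method[OF mD1 ED1(1) e] ED1(2) divide_right_mono[OF ED1(2), of "e\<^sup>2"] by simp
  have S1: "{\<omega>\<in>space M. norm (D1 \<omega>) \<ge> e} \<in> sets M"
    by (rule borel_measurable_le[OF borel_measurable_const mD1])
  define N where "N i = {\<omega>\<in>space M. emeasure (\<eta> \<omega>) (A i) \<noteq> 0}" for i
  have N: "N i \<in> sets M" for i unfolding N_def using As by measurable
  have P2: "prob (\<Union>i\<in>L. N i) \<le> r"
  proof -
    have "prob (\<Union>i\<in>L. N i) \<le> (\<Sum>i\<in>L. prob (N i))" using IL N by (intro measure_UNION_le) auto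
    also have "\<dots> \<le> (\<Sum>i\<in>L. ?w i)"
    proof (rule sum_mono)
      fix i assume i: "i \<in> L"
      have "prob (N i) \<le> measure C (A i)"
        unfolding N_def using i by (intro prob_\<eta>_nonzero_le As fin) (auto simp: L_def)
      also have "\<dots> \<le> ?w i"
        unfolding wL[OF i] using mult_left_mono[of 1 "norm (c i)" "measure C (A i)"] i by (simp add: L_def)
      finally show "prob (N i) \<le> ?w i" .
    qed
    finally show ?thesis using rL by simp
  qed
  have "prob {\<omega>\<in>space M. norm (\<Sum>i<k. X i \<omega> *\<^sub>R c i) > 2 * e}
      \<le> prob ({\<omega>\<in>space M. norm (D1 \<omega>) \<ge> e} \<union> (\<Union>i\<in>L. N i))"
  proof (rule finite_measure_mono)
    show "{\<omega>\<in>space M. norm (D1 \<omega>) \<ge> e} \<union> (\<Union>i\<in>L. N i) \<in> sets M"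
      using S1 N IL by (intro sets.Un sets.finite_UN)
    show "{\<omega>\<in>space M. norm (\<Sum>i<k. X i \<omega> *\<^sub>R c i) > 2 * e} \<subseteq> {\<omega>\<in>space M. norm (D1 \<omega>) \<ge> e} \<union> (\<Union>i\<in>L. N i)"
    proof (rule subsetI, rule ccontr)
      fix \<omega> assume 1: "\<omega> \<in> {\<omega>\<in>space M. norm (\<Sum>i<k. X i \<omega> *\<^sub>R c i) > 2 * e}"
        and 2: "\<omega> \<notin> {\<omega>\<in>space M. norm (D1 \<omega>) \<ge> e} \<union> (\<Union>i\<in>L. N i)"
      have "norm (D2 \<omega>) \<le> (\<Sum>i\<in>L. norm (X i \<omega> *\<^sub>R c i))" unfolding D2_def by (rule norm_sum)
      also have "\<dots> \<le> (\<Sum>i\<in>L. ?w i)"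
      proof (rule sum_mono)
        fix i assume i: "i \<in> L"
        have "measure (\<eta> \<omega>) (A i) = 0" using 1 2 i by (auto simp: N_def measure_def)
        then have "norm (X i \<omega> *\<^sub>R c i) = measure C (A i) * norm (c i)" by (simp add: X_def)
        then show "norm (X i \<omega> *\<^sub>R c i) \<le> ?w i" by (simp only: wL[OF i])
      qed
      finally have "norm (D2 \<omega>) \<le> e" using rL r(2) by simp
      moreover have "norm (D1 \<omega>) < e" using 1 2 by auto
      ultimately have "norm (D1 \<omega> + D2 \<omega>) < 2 * e" using norm_triangle_ineq[of "D1 \<omega>" "D2 \<omega>"] by simp
      then show False using 1 by (simp add: D)
    qed
  qed
  also have "\<dots> \<le> r / e\<^sup>2 + r"
    using S1 N IL P1 P2 by (intro measure_Un_le[THEN order_trans] add_mono sets.finite_UN)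
  finally show ?thesis by (simp add: X_def)
qed

section \<open>Integrals of simple integrands and translation by one jump\<close>

definition cint :: "(real \<times> real \<Rightarrow> 'a) \<Rightarrow> 'w \<Rightarrow> 'a::real_vector" where
  "cint \<phi> \<omega> = Bochner_Integration.simple_bochner_integral (\<eta> \<omega>) \<phi> - Bochner_Integration.simple_bochner_integral C \<phi>"

definition deviation :: "(real \<times> real \<Rightarrow> 'a::real_normed_vector) \<Rightarrow> (real \<times> real \<Rightarrow> 'a) \<Rightarrow> ennreal" where
  "deviation \<phi> \<Phi> = (\<integral>\<^sup>+p. ennreal (min (norm (\<phi> p - \<Phi> p)) ((norm (\<phi> p - \<Phi> p))\<^sup>2)) \<partial>C)"

text \<open>Translation by the constant compensator term is continuous, so this term can be absorbed
  into \<open>X\<close>; what remains has the form covered by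
  \<open>borel_measurable_norm_sum_diff\<close>.\<close>

lemma measurable_norm_cint_diff:
  fixes X :: "'w \<Rightarrow> 'a::real_inner"
  assumes \<phi>: "Bochner_Integration.simple_bochner_integrable C \<phi>" and X: "X \<in> borel_measurable M"
  shows "(\<lambda>\<omega>. norm (cint \<phi> \<omega> - X \<omega>)) \<in> borel_measurable M"
proof -
  obtain k :: nat and A c where A: "disjoint_family A" "range A \<subseteq> sets C" "(\<Union>i<k. A i) = space C"
    and c: "\<And>i p. i < k \<Longrightarrow> p \<in> A i \<Longrightarrow> \<phi> p = c i"
    and fin: "\<And>i. i < k \<Longrightarrow> c i \<noteq> 0 \<Longrightarrow> emeasure C (A i) < \<infinity>"
    and sbi: "\<And>N. sets N = sets C \<Longrightarrow> Bochner_Integration.simple_bochner_integral N \<phi> = (\<Sum>i<k. measure N (A i) *\<^sub>R c i)"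
    by (rule simple_bochner_integral_finite_partition[OF \<phi>], rule that)
  let ?m = "Bochner_Integration.simple_bochner_integral C \<phi>"
  have "(\<lambda>\<omega>. X \<omega> + ?m) \<in> borel_measurable M"
    using measurable_compose[OF X borel_measurable_continuous_onI[of "\<lambda>v. v + ?m"]]
    by (simp add: continuous_intros)
  then have "(\<lambda>\<omega>. norm ((\<Sum>i<k. measure (\<eta> \<omega>) (A i) *\<^sub>R c i) - (X \<omega> + ?m))) \<in> borel_measurable M"
    using A(2) by (intro borel_measurable_norm_sum_diff measurable_measure_\<eta>) auto
  then show ?thesis
    by (rule measurable_cong[THEN iffD1, rotated]) (simp add: cint_def sbi sets_\<eta> algebra_simps)
qed

lemma measurable_norm_diff_const:
  fixes X :: "'w \<Rightarrow> 'a::real_normed_vector"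
  assumes X: "X \<in> borel_measurable M"
  shows "(\<lambda>\<omega>. norm (X \<omega> - y)) \<in> borel_measurable M"
  using measurable_compose[OF X borel_measurable_continuous_onI[of "\<lambda>v. norm (v - y)"]]
  by (simp add: continuous_intros)

text \<open>Conditioned on a single jump in \<open>G\<close>, the integral is shifted by about \<open>h\<close>, independently
  of the jumps outside \<open>G\<close>; without a jump in \<open>G\<close> only the latter contribute.\<close>

lemma prob_translate_ge:
  fixes X :: "'w \<Rightarrow> 'a::real_inner"
  assumes \<phi>: "Bochner_Integration.simple_bochner_integrable C \<phi>" and X: "X \<in> borel_measurable M"
    and G: "G \<in> sets C" "emeasure C G < \<infinity>" and e: "e > 0"
    and Gh: "AE p in C. p \<in> G \<longrightarrow> norm (\<Phi> p - h) \<le> e"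
    and r': "deviation \<phi> \<Phi> \<le> ennreal r'" "0 \<le> r'"
  defines "d \<equiv> prob {\<omega>\<in>space M. norm (cint \<phi> \<omega> - X \<omega>) > e}"
  shows "(prob {\<omega>\<in>space M. norm (X \<omega> - y) < r} - measure C G - d) * (measure C G * exp (- measure C G))
      \<le> prob {\<omega>\<in>space M. norm (X \<omega> - (y + h)) < r + 4 * e} + d + r' / min e (e\<^sup>2)"
proof -
  obtain k :: nat and A c where A: "disjoint_family A" "range A \<subseteq> sets C" "(\<Union>i<k. A i) = space C"
    and c: "\<And>i p. i < k \<Longrightarrow> p \<in> A i \<Longrightarrow> \<phi> p = c i"
    and fin: "\<And>i. i < k \<Longrightarrow> c i \<noteq> 0 \<Longrightarrow> emeasure C (A i) < \<infinity>"
    and sbi: "\<And>N. sets N = sets C \<Longrightarrow> Bochner_Integration.simple_bochner_integral N \<phi> = (\<Sum>i<k. measure N (A i) *\<^sub>R c i)"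
    by (rule simple_bochner_integral_finite_partition[OF \<phi>], rule that)
  have As: "A i \<in> sets C" for i using A(2) by auto
  define m where "m = Bochner_Integration.simple_bochner_integral C \<phi>"
  \<comment> \<open>\<open>Y\<close> drops the jumps in \<open>G\<close> but keeps the whole
    compensator \<open>m\<close>, so the integral is exactly \<open>Y\<close> plus the jumps in
    \<open>G\<close>.\<close>
  define Y where "Y \<omega> = (\<Sum>i<k. measure (\<eta> \<omega>) (A i - G) *\<^sub>R c i) - m" for \<omega>
  \<comment> \<open>The part of \<open>G\<close> where the simple integrand is far from
    \<open>h\<close>. There it is also far from \<open>\<Phi>\<close>, so the deviation controls its
    intensity.\<close>
  define bad where "bad = (\<Union>i\<in>{i. i < k \<and> norm (c i - h) > 2 * e}. A i \<inter> G)"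
  have bad: "bad \<in> sets C" "bad \<subseteq> G"
    unfolding bad_def using As G by (auto intro!: sets.finite_UN)
  have badfin: "emeasure C bad < \<infinity>"
    using emeasure_mono[OF bad(2) G(1)] G(2) by (rule le_less_trans)
  let ?q = "measure C G * exp (- measure C G)"
  define E1 where "E1 = {\<omega>\<in>space M. norm (X \<omega> - y) < r}"
  define E2 where "E2 = {\<omega>\<in>space M. emeasure (\<eta> \<omega>) G \<noteq> 0}"
  define E3 where "E3 = {\<omega>\<in>space M. norm (cint \<phi> \<omega> - X \<omega>) > e}"
  define E4 where "E4 = {\<omega>\<in>space M. norm (Y \<omega> - y) < r + e}"
  define E5 where "E5 = {\<omega>\<in>space M. emeasure (\<eta> \<omega>) bad \<noteq> 0}"
  define E6 where "E6 = {\<omega>\<in>space M. norm (X \<omega> - (y + h)) < r + 4 * e}"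
  define N1 where "N1 = {\<omega>\<in>space M. emeasure (\<eta> \<omega>) G = 1}"
  have Ynorm: "norm (Y \<omega> - y) = norm ((\<Sum>i<k. measure (\<eta> \<omega>) (A i - G) *\<^sub>R c i) - (m + y))" for \<omega>
    by (simp add: Y_def algebra_simps)
  have mY: "(\<lambda>\<omega>. norm (Y \<omega> - y)) \<in> borel_measurable M"
    unfolding Ynorm using As G by (intro borel_measurable_norm_sum_diff measurable_measure_\<eta>) auto
  have sets: "E1 \<in> sets M" "E2 \<in> sets M" "E3 \<in> sets M" "E4 \<in> sets M" "E5 \<in> sets M" "E6 \<in> sets M"
    unfolding E1_def E2_def E3_def E4_def E5_def E6_def
    using measurable_norm_diff_const[OF X, of y] measurable_norm_diff_const[OF X, of "y + h"]
      measurable_emeasure_\<eta>[OF G(1)] measurable_emeasure_\<eta>[OF bad(1)]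
      measurable_norm_cint_diff[OF \<phi> X] mY
    by measurable
  \<comment> \<open>The default value 0 of \<open>enn2real\<close> at infinity cannot be mistaken
    for a single jump.\<close>
  have enn2real_eq_1_iff: "enn2real v = 1 \<longleftrightarrow> v = 1" for v
    by (cases v) auto
  have dec: "AE \<omega> in M. emeasure (\<eta> \<omega>) G < \<infinity> \<and> (\<forall>i\<in>{i. i < k \<and> c i \<noteq> 0}. emeasure (\<eta> \<omega>) (A i) < \<infinity>)"
    by (intro AE_conjI AE_finite_allI AE_\<eta>_finite G As fin) auto
  have dec2: "AE \<omega> in M. \<omega> \<in> space M \<and> emeasure (\<eta> \<omega>) G < \<infinity>
      \<and> cint \<phi> \<omega> = Y \<omega> + (\<Sum>i<k. measure (\<eta> \<omega>) (A i \<inter> G) *\<^sub>R c i)"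
    using dec AE_space
  proof eventually_elim
    case (elim \<omega>)
    have s: "sets (\<eta> \<omega>) = sets C" by (rule sets_\<eta>) (use elim in simp)
    have "measure (\<eta> \<omega>) (A i) *\<^sub>R c i = measure (\<eta> \<omega>) (A i - G) *\<^sub>R c i + measure (\<eta> \<omega>) (A i \<inter> G) *\<^sub>R c i" if "i < k" for i
    proof (cases "c i = 0")
      case False
      then have f: "emeasure (\<eta> \<omega>) (A i) \<noteq> \<infinity>" using elim that by auto
      have "measure (\<eta> \<omega>) (A i - (A i \<inter> G)) = measure (\<eta> \<omega>) (A i) - measure (\<eta> \<omega>) (A i \<inter> G)"
        by (rule measure_Diff[OF f]) (use s As G in auto)
      moreover have "A i - (A i \<inter> G) = A i - G" by auto
      ultimately show ?thesis by (simp flip: scaleR_add_left)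
    qed simp
    then have "(\<Sum>i<k. measure (\<eta> \<omega>) (A i) *\<^sub>R c i)
        = (\<Sum>i<k. measure (\<eta> \<omega>) (A i - G) *\<^sub>R c i) + (\<Sum>i<k. measure (\<eta> \<omega>) (A i \<inter> G) *\<^sub>R c i)"
      by (simp add: sum.distrib)
    then show ?case using elim by (simp add: cint_def Y_def m_def sbi[OF s])
  qed
  have step1: "prob E1 \<le> prob (E4 \<union> E2 \<union> E3)"
  proof (rule finite_measure_mono_AE)
    show "AE \<omega> in M. \<omega> \<in> E1 \<longrightarrow> \<omega> \<in> E4 \<union> E2 \<union> E3"
      using dec2
    proof eventually_elim
      case (elim \<omega>)
      show ?case
      proof (rule impI, rule ccontr)
        assume 1: "\<omega> \<in> E1" "\<omega> \<notin> E4 \<union> E2 \<union> E3"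
        then have 0: "emeasure (\<eta> \<omega>) G = 0" using elim by (auto simp: E2_def)
        have "measure (\<eta> \<omega>) (A i \<inter> G) = 0" for i
          using emeasure_mono[of "A i \<inter> G" G "\<eta> \<omega>"] 0 G(1) sets_\<eta> elim by (simp add: measure_def)
        then have "cint \<phi> \<omega> = Y \<omega>" using elim by simp
        then have "norm (Y \<omega> - X \<omega>) \<le> e" "norm (X \<omega> - y) < r" "\<not> norm (Y \<omega> - y) < r + e"
          using 1 elim by (auto simp: E1_def E3_def E4_def)
        then show False using norm_triangle_ineq[of "Y \<omega> - X \<omega>" "X \<omega> - y"] by simp
      qed
    qed
    show "E4 \<union> E2 \<union> E3 \<in> sets M" using sets by auto
  qed
  have "prob (E4 \<union> E2 \<union> E3) \<le> prob E4 + prob E2 + prob E3"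
    using sets by (intro measure_Un_le[THEN order_trans] add_mono measure_Un_le sets.Un order_refl)
  moreover have "prob E2 \<le> measure C G" unfolding E2_def by (rule prob_\<eta>_nonzero_le[OF G])
  ultimately have pE4: "prob E1 - measure C G - d \<le> prob E4"
    using step1 by (simp add: d_def E3_def)
  have "prob (N1 \<inter> E4) = prob N1 * prob E4"
  proof -
    \<comment> \<open>Index 0 carries \<open>G\<close> and index \<open>Suc i\<close> the part of
      \<open>A i\<close> outside it. Independence of this one disjoint sequence separates the count
      in \<open>G\<close> from \<open>Y\<close>.\<close>
    define Bs where "Bs = case_nat G (\<lambda>i. A i - G)"
    have Bs: "range Bs \<subseteq> sets C"
      using As G by (auto simp: Bs_def split: nat.split)
    have Bd: "disjoint_family Bs"
      using A(1) by (auto simp: Bs_def disjoint_family_on_def split: nat.split)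
    have ind: "indep_var (PiM {0} (\<lambda>_. borel)) (\<lambda>\<omega>. restrict (\<lambda>i. emeasure (\<eta> \<omega>) (Bs i)) {0})
       (PiM {1..} (\<lambda>_. borel)) (\<lambda>\<omega>. restrict (\<lambda>i. emeasure (\<eta> \<omega>) (Bs i)) {1..})"
      by (rule indep_var_restrict[OF indep_vars_\<eta>[OF Bs Bd]]) auto
    have "indep_var borel ((\<lambda>f. enn2real (f 0)) \<circ> (\<lambda>\<omega>. restrict (\<lambda>i. emeasure (\<eta> \<omega>) (Bs i)) {0}))
       borel ((\<lambda>f. norm ((\<Sum>i<k. enn2real (f (Suc i)) *\<^sub>R c i) - (m + y))) \<circ> (\<lambda>\<omega>. restrict (\<lambda>i. emeasure (\<eta> \<omega>) (Bs i)) {1..}))"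
    proof (rule indep_var_compose[OF ind])
      have "(\<lambda>f. f 0) \<in> PiM {0} (\<lambda>_. borel) \<rightarrow>\<^sub>M (borel :: ennreal measure)"
        by (rule measurable_component_singleton) simp
      then show "(\<lambda>f. enn2real (f 0)) \<in> borel_measurable (PiM {0} (\<lambda>_. borel :: ennreal measure))"
        by measurable
      show "(\<lambda>f. norm ((\<Sum>i<k. enn2real (f (Suc i)) *\<^sub>R c i) - (m + y))) \<in> PiM {1..} (\<lambda>_. borel) \<rightarrow>\<^sub>M borel"
      proof (rule borel_measurable_norm_sum_diff)
        fix i
        have "(\<lambda>f. f (Suc i)) \<in> PiM {1..} (\<lambda>_. borel :: ennreal measure) \<rightarrow>\<^sub>M borel"
          by (rule measurable_component_singleton) simp
        then show "(\<lambda>f. enn2real (f (Suc i))) \<in> borel_measurable (PiM {1..} (\<lambda>_. borel :: ennreal measure))"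
          by measurable
      qed simp
    qed
    moreover have "((\<lambda>f. enn2real (f 0)) \<circ> (\<lambda>\<omega>. restrict (\<lambda>i. emeasure (\<eta> \<omega>) (Bs i)) {0})) = (\<lambda>\<omega>. measure (\<eta> \<omega>) G)"
      by (auto simp: Bs_def measure_def)
    moreover have "((\<lambda>f. norm ((\<Sum>i<k. enn2real (f (Suc i)) *\<^sub>R c i) - (m + y))) \<circ> (\<lambda>\<omega>. restrict (\<lambda>i. emeasure (\<eta> \<omega>) (Bs i)) {1..}))
        = (\<lambda>\<omega>. norm (Y \<omega> - y))"
      by (auto simp: Bs_def Ynorm measure_def)
    ultimately have "indep_var borel (\<lambda>\<omega>. measure (\<eta> \<omega>) G) borel (\<lambda>\<omega>. norm (Y \<omega> - y))" by simp
    from indep_varD[OF this, of "{1}" "{..<r + e}"]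
    have "prob ((\<lambda>\<omega>. (measure (\<eta> \<omega>) G, norm (Y \<omega> - y))) -` ({1} \<times> {..<r + e}) \<inter> space M)
       = prob ((\<lambda>\<omega>. measure (\<eta> \<omega>) G) -` {1} \<inter> space M) * prob ((\<lambda>\<omega>. norm (Y \<omega> - y)) -` {..<r + e} \<inter> space M)"
      by simp
    moreover have "(\<lambda>\<omega>. (measure (\<eta> \<omega>) G, norm (Y \<omega> - y))) -` ({1} \<times> {..<r + e}) \<inter> space M = N1 \<inter> E4"
      "(\<lambda>\<omega>. measure (\<eta> \<omega>) G) -` {1} \<inter> space M = N1" "(\<lambda>\<omega>. norm (Y \<omega> - y)) -` {..<r + e} \<inter> space M = E4"
      by (auto simp: N1_def E4_def measure_def enn2real_eq_1_iff)
    ultimately show ?thesis by simp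
  qed
  moreover have "prob N1 = ?q"
    using prob_\<eta>_eq[OF G, of 1] by (simp add: N1_def)
  ultimately have pN: "prob (N1 \<inter> E4) = prob E4 * ?q" by simp
  have "prob (N1 \<inter> E4) \<le> prob (E6 \<union> E3 \<union> E5)"
  proof (rule finite_measure_mono_AE)
    show "AE \<omega> in M. \<omega> \<in> N1 \<inter> E4 \<longrightarrow> \<omega> \<in> E6 \<union> E3 \<union> E5"
      using dec2
    proof eventually_elim
      case (elim \<omega>)
      show ?case
      proof (rule impI, rule ccontr)
        assume 1: "\<omega> \<in> N1 \<inter> E4" "\<omega> \<notin> E6 \<union> E3 \<union> E5"
        have s: "sets (\<eta> \<omega>) = sets C" by (rule sets_\<eta>) (use elim in simp)
        have f: "emeasure (\<eta> \<omega>) G = 1" using 1 by (simp add: N1_def)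
        have fi: "emeasure (\<eta> \<omega>) (A i \<inter> G) \<noteq> \<infinity>" for i
          using emeasure_mono[of "A i \<inter> G" G "\<eta> \<omega>"] f G(1) s by (auto simp: top_unique)
        \<comment> \<open>One jump in \<open>G\<close> makes the weights sum to 1, so
          \<open>?Z\<close> is a convex combination of the \<open>c i\<close>. Those far from
          \<open>h\<close> have weight 0 because no jump falls into \<open>bad\<close>.\<close>
        have "G = (\<Union>i<k. A i \<inter> G)" using A(3) sets.sets_into_space[OF G(1)] by auto
        then have "1 = measure (\<eta> \<omega>) (\<Union>i<k. A i \<inter> G)" using f by (simp add: measure_def)
        also have "\<dots> = (\<Sum>i<k. measure (\<eta> \<omega>) (A i \<inter> G))"
          using A(1) As G s by (intro measure_finite_Union fi) (auto simp: disjoint_family_on_def)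
        finally have sum1: "(\<Sum>i<k. measure (\<eta> \<omega>) (A i \<inter> G)) = 1" by simp
        let ?Z = "\<Sum>i<k. measure (\<eta> \<omega>) (A i \<inter> G) *\<^sub>R c i"
        have "?Z - h = (\<Sum>i<k. measure (\<eta> \<omega>) (A i \<inter> G) *\<^sub>R (c i - h))"
          by (simp add: scaleR_diff_right sum_subtractf sum1 flip: scaleR_left.sum)
        also have "norm \<dots> \<le> (\<Sum>i<k. measure (\<eta> \<omega>) (A i \<inter> G) * (2 * e))"
        proof (rule sum_norm_le)
          fix i assume i: "i \<in> {..<k}"
          show "norm (measure (\<eta> \<omega>) (A i \<inter> G) *\<^sub>R (c i - h)) \<le> measure (\<eta> \<omega>) (A i \<inter> G) * (2 * e)"
          proof (cases "norm (c i - h) > 2 * e")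
            case True
            then have "A i \<inter> G \<subseteq> bad" using i by (auto simp: bad_def)
            moreover have "emeasure (\<eta> \<omega>) bad = 0" using 1 elim by (auto simp: E5_def)
            ultimately have "measure (\<eta> \<omega>) (A i \<inter> G) = 0"
              using emeasure_mono[of "A i \<inter> G" bad "\<eta> \<omega>"] bad(1) s by (simp add: measure_def)
            then show ?thesis by simp
          qed (simp add: mult_left_mono)
        qed
        also have "\<dots> = 2 * e" using sum1 by (simp flip: sum_distrib_right)
        finally have Zh: "norm (?Z - h) \<le> 2 * e" .
        \<comment> \<open>The increase of the radius by \<open>4 * e\<close> consists of
          \<open>e\<close> from \<open>Y\<close>, \<open>2 * e\<close> from the jump and
          \<open>e\<close> from the approximation of \<open>X\<close>.\<close>
        have "norm (cint \<phi> \<omega> - X \<omega>) \<le> e" "norm (Y \<omega> - y) < r + e" "\<not> norm (X \<omega> - (y + h)) < r + 4 * e"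
          using 1 elim by (auto simp: E3_def E4_def E6_def)
        moreover have "X \<omega> - (y + h) = (Y \<omega> - y) + (?Z - h) - (cint \<phi> \<omega> - X \<omega>)" using elim by simp
        then have "norm (X \<omega> - (y + h)) = norm ((Y \<omega> - y) + (?Z - h) - (cint \<phi> \<omega> - X \<omega>))" by (rule arg_cong)
        then have "norm (X \<omega> - (y + h)) \<le> norm (Y \<omega> - y) + norm (?Z - h) + norm (cint \<phi> \<omega> - X \<omega>)"
          using norm_triangle_ineq4[of "(Y \<omega> - y) + (?Z - h)" "cint \<phi> \<omega> - X \<omega>"]
            norm_triangle_ineq[of "Y \<omega> - y" "?Z - h"] by linarith
        ultimately show False using Zh by linarith
      qed
    qed
    show "E6 \<union> E3 \<union> E5 \<in> sets M" using sets by auto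
  qed
  also have "\<dots> \<le> prob E6 + prob E3 + prob E5"
    using sets by (intro measure_Un_le[THEN order_trans] add_mono measure_Un_le sets.Un order_refl)
  also have "prob E5 \<le> measure C bad"
    unfolding E5_def by (rule prob_\<eta>_nonzero_le[OF bad(1) badfin])
  also have "measure C bad \<le> r' / min e (e\<^sup>2)"
  proof -
    \<comment> \<open>Markov's inequality: on \<open>bad\<close> the integrands differ by at least
      \<open>e\<close>, so the integrand of the deviation is at least \<open>?\<mu>\<close>
      there.\<close>
    let ?\<mu> = "min e (e\<^sup>2)"
    have mu: "?\<mu> > 0" using e by simp
    have "ennreal ?\<mu> * emeasure C bad = (\<integral>\<^sup>+p. ennreal ?\<mu> * indicator bad p \<partial>C)"
      using bad(1) by (simp add: nn_integral_cmult_indicator)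
    also have "\<dots> \<le> deviation \<phi> \<Phi>"
      unfolding deviation_def
    proof (rule nn_integral_mono_AE)
      show "AE p in C. ennreal ?\<mu> * indicator bad p \<le> ennreal (min (norm (\<phi> p - \<Phi> p)) ((norm (\<phi> p - \<Phi> p))\<^sup>2))"
        using Gh
      proof eventually_elim
        case (elim p)
        show ?case
        proof (cases "p \<in> bad")
          case True
          then obtain i where i: "i < k" "norm (c i - h) > 2 * e" "p \<in> A i" "p \<in> G" by (auto simp: bad_def)
          then have "norm (\<phi> p - h) > 2 * e" "norm (\<Phi> p - h) \<le> e" using c elim by auto
          moreover have "norm (\<phi> p - h) \<le> norm (\<phi> p - \<Phi> p) + norm (\<Phi> p - h)"
            using norm_triangle_ineq[of "\<phi> p - \<Phi> p" "\<Phi> p - h"] by simp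
          ultimately have "e \<le> norm (\<phi> p - \<Phi> p)" by linarith
          then have "?\<mu> \<le> min (norm (\<phi> p - \<Phi> p)) ((norm (\<phi> p - \<Phi> p))\<^sup>2)"
            using e by (intro min.mono power_mono) auto
          then show ?thesis using True by (simp add: ennreal_leI del: min.bounded_iff)
        qed simp
      qed
    qed
    also have "\<dots> \<le> ennreal r'" by (rule r')
    finally have "ennreal ?\<mu> * ennreal (measure C bad) \<le> ennreal r'"
      using badfin by (simp add: emeasure_eq_ennreal_measure)
    then have "?\<mu> * measure C bad \<le> r'"
      using mu r'(2) by (simp flip: ennreal_mult')
    then show ?thesis using mu by (simp add: pos_le_divide_eq mult.commute)
  qed
  finally have "prob E4 * ?q \<le> prob E6 + d + r' / min e (e\<^sup>2)"
    using pN by (simp add: d_def E3_def)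
  moreover have "(prob E1 - measure C G - d) * ?q \<le> prob E4 * ?q"
    by (intro mult_right_mono pE4) simp
  ultimately show ?thesis by (simp add: E1_def E6_def)
qed

lemma deviation_eventually_le:
  assumes "(\<lambda>n. deviation (\<phi> n) \<Phi>) \<longlonglongrightarrow> 0" "a > 0"
  shows "\<forall>\<^sub>F n in sequentially. deviation (\<phi> n) \<Phi> \<le> ennreal a"
proof -
  have "\<forall>\<^sub>F n in sequentially. deviation (\<phi> n) \<Phi> < ennreal a"
    by (rule order_tendstoD(2)[OF assms(1)]) (use assms(2) in simp)
  then show ?thesis by (rule eventually_mono) (rule less_imp_le)
qed

text \<open>The order of choices matters: \<open>G\<close> is fixed first, and with it the
  probability \<open>?q\<close> of a single jump. Only then is \<open>n\<close> taken so large that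
  the approximation errors are small compared with \<open>?q\<close>.\<close>

lemma prob_translate_pos:
  fixes X :: "'w \<Rightarrow> 'a::real_inner"
  assumes \<phi>: "\<And>n. Bochner_Integration.simple_bochner_integrable C (\<phi> n)"
    and dev: "(\<lambda>n. deviation (\<phi> n) \<Phi>) \<longlonglongrightarrow> 0"
    and conv: "converges_in_probability M (\<lambda>n. cint (\<phi> n)) X" and X: "X \<in> borel_measurable M"
    and jump: "\<And>e. e > 0 \<Longrightarrow> \<exists>G\<in>sets C. 0 < emeasure C G \<and> emeasure C G \<le> ennreal e \<and>
        (AE p in C. p \<in> G \<longrightarrow> norm (\<Phi> p - h) \<le> e)"
    and r: "r < r'" and pos: "0 < prob {\<omega>\<in>space M. norm (X \<omega> - y) < r}"
  shows "0 < prob {\<omega>\<in>space M. norm (X \<omega> - (y + h)) < r'}"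
proof -
  let ?p = "prob {\<omega>\<in>space M. norm (X \<omega> - y) < r}"
  \<comment> \<open>The first bound pays for the loss of \<open>4 * e\<close> in the radius. The
    second leaves half of \<open>?p\<close> after subtracting the intensity of \<open>G\<close> and
    the error \<open>d\<close>, each at most \<open>?p / 4\<close>.\<close>
  define e where "e = min ((r' - r) / 4) (?p / 4)"
  have e: "e > 0" "4 * e \<le> r' - r" "e \<le> ?p / 4" using r pos by (auto simp: e_def min_def field_simps)
  obtain G where G: "G \<in> sets C" "0 < emeasure C G" "emeasure C G \<le> ennreal e"
    and Gh: "AE p in C. p \<in> G \<longrightarrow> norm (\<Phi> p - h) \<le> e"
    using jump[OF e(1)] by blast
  have Gf: "emeasure C G < \<infinity>" using G(3) by (rule le_less_trans) simp
  then have CG: "emeasure C G = ennreal (measure C G)" by (simp add: emeasure_eq_ennreal_measure)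
  have m: "0 < measure C G" "measure C G \<le> ?p / 4"
    using G(2,3) e by (auto simp: CG)
  let ?q = "measure C G * exp (- measure C G)"
  let ?\<mu> = "min e (e\<^sup>2)"
  have q: "?q > 0" and mu: "?\<mu> > 0" using m e by auto
  \<comment> \<open>With this choice the left side of \<open>prob_translate_ge\<close> is at least
    \<open>4 * s\<close>, while the two error terms add up to less than
    \<open>2 * s\<close>.\<close>
  define s where "s = ?p * ?q / 8"
  have s: "s > 0" using pos q by (simp add: s_def)
  have "(\<lambda>n. prob {\<omega>\<in>space M. norm (cint (\<phi> n) \<omega> - X \<omega>) > e}) \<longlonglongrightarrow> 0"
    using conv e(1) by (simp add: converges_in_probability_def)
  then have "\<forall>\<^sub>F n in sequentially. prob {\<omega>\<in>space M. norm (cint (\<phi> n) \<omega> - X \<omega>) > e} < min (?p / 4) s"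
    by (rule order_tendstoD) (use pos s in auto)
  moreover have "\<forall>\<^sub>F n in sequentially. deviation (\<phi> n) \<Phi> \<le> ennreal (s * ?\<mu>)"
    using s mu by (intro deviation_eventually_le dev) (simp only: mult_pos_pos)
  ultimately have "\<forall>\<^sub>F n in sequentially. prob {\<omega>\<in>space M. norm (cint (\<phi> n) \<omega> - X \<omega>) > e} < min (?p / 4) s
      \<and> deviation (\<phi> n) \<Phi> \<le> ennreal (s * ?\<mu>)"
    by (rule eventually_conj)
  then obtain n where n: "prob {\<omega>\<in>space M. norm (cint (\<phi> n) \<omega> - X \<omega>) > e} < min (?p / 4) s"
      "deviation (\<phi> n) \<Phi> \<le> ennreal (s * ?\<mu>)"
    by (auto simp: eventually_sequentially)
  define d where "d = prob {\<omega>\<in>space M. norm (cint (\<phi> n) \<omega> - X \<omega>) > e}"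
  have d: "d < ?p / 4" "d < s" using n(1) by (auto simp: d_def)
  have "(?p - measure C G - d) * ?q
      \<le> prob {\<omega>\<in>space M. norm (X \<omega> - (y + h)) < r + 4 * e} + d + s * ?\<mu> / ?\<mu>"
    unfolding d_def
    by (rule prob_translate_ge[OF \<phi> X G(1) Gf e(1) Gh n(2)]) (use s mu in \<open>simp only: mult_nonneg_nonneg less_imp_le\<close>)
  moreover have "s * ?\<mu> / ?\<mu> = s" by (rule nonzero_mult_div_cancel_right) (use mu in linarith)
  moreover have "?p / 2 * ?q \<le> (?p - measure C G - d) * ?q"
    using m d q by (intro mult_right_mono) linarith+
  moreover have "?p / 2 * ?q = 4 * s" by (simp add: s_def)
  ultimately have "0 < prob {\<omega>\<in>space M. norm (X \<omega> - (y + h)) < r + 4 * e}"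
    using d s by linarith
  also have "\<dots> \<le> prob {\<omega>\<in>space M. norm (X \<omega> - (y + h)) < r'}"
  proof (rule finite_measure_mono)
    show "{\<omega>\<in>space M. norm (X \<omega> - (y + h)) < r'} \<in> sets M"
      by (intro borel_measurable_less measurable_norm_diff_const X borel_measurable_const)
  qed (use e in auto)
  finally show ?thesis .
qed

text \<open>No separability of \<open>V\<close> is needed: the approximating integrals take countably many values,
  as \<open>\<eta>\<close> is integer-valued.\<close>

lemma exists_prob_ball_pos:
  fixes X :: "'w \<Rightarrow> 'a::real_inner"
  assumes \<phi>: "\<And>n. Bochner_Integration.simple_bochner_integrable C (\<phi> n)"
    and dev: "(\<lambda>n. deviation (\<phi> n) \<Phi>) \<longlonglongrightarrow> 0"
    and conv: "converges_in_probability M (\<lambda>n. cint (\<phi> n)) X" and X: "X \<in> borel_measurable M"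
    and V: "subspace V" "closed V" "AE p in C. \<Phi> p \<in> V" and e: "e > 0"
  shows "\<exists>q\<in>V. 0 < prob {\<omega>\<in>space M. norm (X \<omega> - q) < 4 * e}"
proof -
  \<comment> \<open>Passing to near-projections costs a factor 4 below, so \<open>4 * s\<close>
    takes the role of \<open>r\<close> in \<open>prob_compensated_sum_le\<close>. The choice makes
    that bound at most \<open>1 / 4\<close>.\<close>
  define s where "s = min (e / 4) (1 / 16 / (1 / e\<^sup>2 + 1))"
  have e2: "1 / e\<^sup>2 + 1 > 0" by (simp add: add_nonneg_pos)
  have s: "s > 0" "4 * s \<le> e" "4 * s / e\<^sup>2 + 4 * s \<le> 1 / 4"
  proof -
    show "s > 0" "4 * s \<le> e" using e e2 by (auto simp: s_def)
    have "s \<le> 1 / 16 / (1 / e\<^sup>2 + 1)" by (simp add: s_def)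
    then have "s * (1 / e\<^sup>2 + 1) \<le> 1 / 16" by (simp only: pos_le_divide_eq[OF e2])
    then show "4 * s / e\<^sup>2 + 4 * s \<le> 1 / 4" by (simp add: algebra_simps)
  qed
  have "(\<lambda>n. prob {\<omega>\<in>space M. norm (cint (\<phi> n) \<omega> - X \<omega>) > e}) \<longlonglongrightarrow> 0"
    using conv e by (simp add: converges_in_probability_def)
  then have "\<forall>\<^sub>F n in sequentially. prob {\<omega>\<in>space M. norm (cint (\<phi> n) \<omega> - X \<omega>) > e} < 1 / 4"
    by (rule order_tendstoD) simp
  from eventually_conj[OF this deviation_eventually_le[OF dev s(1)]]
  obtain n where n: "prob {\<omega>\<in>space M. norm (cint (\<phi> n) \<omega> - X \<omega>) > e} < 1 / 4"
      "deviation (\<phi> n) \<Phi> \<le> ennreal s"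
    by (auto simp: eventually_sequentially)
  obtain k :: nat and A c where A: "disjoint_family A" "range A \<subseteq> sets C" "(\<Union>i<k. A i) = space C"
    and c: "\<And>i p. i < k \<Longrightarrow> p \<in> A i \<Longrightarrow> \<phi> n p = c i"
    and fin: "\<And>i. i < k \<Longrightarrow> c i \<noteq> 0 \<Longrightarrow> emeasure C (A i) < \<infinity>"
    and sbi: "\<And>N. sets N = sets C \<Longrightarrow> Bochner_Integration.simple_bochner_integral N (\<phi> n) = (\<Sum>i<k. measure N (A i) *\<^sub>R c i)"
    by (rule simple_bochner_integral_finite_partition[OF \<phi>[of n]], rule that)
  have V0: "0 \<in> V" using V(1) by (rule subspace_0)
  \<comment> \<open>Near-projections onto \<open>V\<close>: the factor 2 gives room when the
    distance is not attained.\<close>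
  have "\<exists>a\<in>V. norm (v - a) \<le> 2 * infdist v V" for v
  proof (cases "v \<in> V")
    case False
    then have "0 < infdist v V" using V(2) V0 by (intro infdist_pos_not_in_closed) auto
    moreover have "(INF a\<in>V. dist v a) = infdist v V" using V0 by (subst infdist_notempty) auto
    ultimately have "(INF a\<in>V. dist v a) < 2 * infdist v V" by linarith
    then obtain a where "a \<in> V" "dist v a < 2 * infdist v V"
      using V0 by (subst (asm) cINF_less_iff) (auto intro!: bdd_belowI[of _ 0])
    then show ?thesis by (auto simp: dist_norm intro: less_imp_le)
  qed (auto intro: bexI[of _ v])
  then obtain pr where pr: "pr v \<in> V" "norm (v - pr v) \<le> 2 * infdist v V" for v by metis
  \<comment> \<open>Emptying the cells with coefficient 0 makes all intensities finite without
    changing the integral.\<close>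
  define A' where "A' i = (if i < k \<and> c i \<noteq> 0 then A i else {})" for i
  have A': "range A' \<subseteq> sets C" "disjoint_family A'"
    using A(1,2) by (auto simp: A'_def disjoint_family_on_def)
  have A's: "A' i \<in> sets C" for i using A'(1) by auto
  have fin': "emeasure C (A' i) < \<infinity>" for i using fin by (auto simp: A'_def)
  define d where "d i = c i - pr (c i)" for i
  let ?\<delta> = "\<lambda>i. infdist (c i) V"
  let ?g = "\<lambda>x::real. min x (x\<^sup>2)"
  have gd: "?g (norm (d i)) \<le> 4 * ?g (?\<delta> i)" for i
  proof -
    have 1: "norm (d i) \<le> 2 * ?\<delta> i" using pr(2) by (simp add: d_def)
    have "(norm (d i))\<^sup>2 \<le> (2 * ?\<delta> i)\<^sup>2" by (rule power_mono[OF 1]) simp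
    then have "(norm (d i))\<^sup>2 \<le> 4 * (?\<delta> i)\<^sup>2" by (simp add: power2_eq_square)
    moreover have "norm (d i) \<le> 4 * ?\<delta> i" using 1 infdist_nonneg[of "c i" V] by linarith
    ultimately show ?thesis by (simp add: min_def)
  qed
  \<comment> \<open>As \<open>\<Phi>\<close> takes values in \<open>V\<close>, the distance from
    \<open>c i\<close> to \<open>V\<close> is at most the approximation error on the cell, so the
    deviation bounds the weighted distances.\<close>
  have "ennreal (\<Sum>i<k. measure C (A' i) * ?g (?\<delta> i)) = (\<Sum>i<k. ennreal (?g (?\<delta> i)) * emeasure C (A' i))"
    using fin' by (simp add: emeasure_eq_ennreal_measure ennreal_mult'' infdist_nonneg mult.commute sum_nonneg less_top flip: sum_ennreal)
  also have "\<dots> = (\<integral>\<^sup>+p. (\<Sum>i<k. ennreal (?g (?\<delta> i)) * indicator (A' i) p) \<partial>C)"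
    using A's by (subst nn_integral_sum) (simp_all only: nn_integral_cmult_indicator borel_measurable_times_ennreal
        borel_measurable_const borel_measurable_indicator)
  also have "\<dots> \<le> deviation (\<phi> n) \<Phi>"
    unfolding deviation_def
  proof (rule nn_integral_mono_AE)
    show "AE p in C. (\<Sum>i<k. ennreal (?g (?\<delta> i)) * indicator (A' i) p) \<le> ennreal (?g (norm (\<phi> n p - \<Phi> p)))"
      using V(3)
    proof eventually_elim
      case (elim p)
      show ?case
      proof (cases "\<exists>i<k. p \<in> A' i")
        case True
        then obtain i where i: "i < k" "p \<in> A' i" by auto
        have "(\<Sum>l<k. ennreal (?g (?\<delta> l)) * indicator (A' l) p) = (\<Sum>l<k. if l = i then ennreal (?g (?\<delta> l)) else 0)"
          by (rule sum.cong) (use i A'(2) in \<open>auto simp: disjoint_family_on_def indicator_def\<close>)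
        also have "\<dots> = ennreal (?g (?\<delta> i))" using i by simp
        also have "\<dots> \<le> ennreal (?g (norm (\<phi> n p - \<Phi> p)))"
        proof -
          have "\<phi> n p = c i" using i c by (auto simp: A'_def split: if_splits)
          then have "?\<delta> i \<le> norm (\<phi> n p - \<Phi> p)" using infdist_le[OF elim, of "c i"] by (simp add: dist_norm)
          then show ?thesis by (intro ennreal_leI min.mono power_mono infdist_nonneg)
        qed
        finally show ?thesis .
      qed (simp add: indicator_def)
    qed
  qed
  also have "\<dots> \<le> ennreal s" by (rule n(2))
  finally have "(\<Sum>i<k. measure C (A' i) * ?g (?\<delta> i)) \<le> s" using s(1) by simp
  moreover have "(\<Sum>i<k. measure C (A' i) * ?g (norm (d i))) \<le> (\<Sum>i<k. 4 * (measure C (A' i) * ?g (?\<delta> i)))"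
    using mult_left_mono[OF gd, of "measure C (A' _)"] by (intro sum_mono) (simp add: mult.left_commute)
  ultimately have "(\<Sum>i<k. measure C (A' i) * ?g (norm (d i))) \<le> 4 * s"
    by (simp flip: sum_distrib_left)
  note small = prob_compensated_sum_le[OF A' fin' e this s(2)]
  let ?D = "\<lambda>\<omega>. \<Sum>i<k. (measure (\<eta> \<omega>) (A' i) - measure C (A' i)) *\<^sub>R d i"
  let ?Q = "\<lambda>\<omega>. \<Sum>i<k. (measure (\<eta> \<omega>) (A' i) - measure C (A' i)) *\<^sub>R pr (c i)"
  define Q where "Q = (\<lambda>m :: nat \<Rightarrow> nat. \<Sum>i<k. (real (m i) - measure C (A' i)) *\<^sub>R pr (c i)) ` (PiE {..<k} (\<lambda>_. UNIV))"
  have Qc: "countable Q" unfolding Q_def by (intro countable_image countable_PiE) auto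
  have QV: "Q \<subseteq> V" unfolding Q_def using V(1) pr(1) by (auto intro!: subspace_sum subspace_scale)
  have QAE: "AE \<omega> in M. ?Q \<omega> \<in> Q"
  proof -
    have "AE \<omega> in M. \<forall>i\<in>{..<k}. \<exists>m. emeasure (\<eta> \<omega>) (A' i) = of_nat m"
      by (intro AE_finite_allI AE_\<eta>_nat A's fin') simp
    then show ?thesis
    proof eventually_elim
      case (elim \<omega>)
      then have "\<forall>i\<in>{..<k}. \<exists>m. measure (\<eta> \<omega>) (A' i) = real m"
        unfolding measure_def by (metis enn2real_of_nat)
      then obtain m where m: "\<And>i. i < k \<Longrightarrow> measure (\<eta> \<omega>) (A' i) = real (m i)"
        by (metis lessThan_iff)
      then show ?case unfolding Q_def
        by (intro image_eqI[of _ _ "restrict m {..<k}"]) auto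
    qed
  qed
  have cintD: "cint (\<phi> n) \<omega> = ?D \<omega> + ?Q \<omega>" if "\<omega> \<in> space M" for \<omega>
  proof -
    have "cint (\<phi> n) \<omega> = (\<Sum>i<k. (measure (\<eta> \<omega>) (A i) - measure C (A i)) *\<^sub>R c i)"
      using that by (simp add: cint_def sbi sets_\<eta> scaleR_diff_left sum_subtractf)
    also have "\<dots> = (\<Sum>i<k. (measure (\<eta> \<omega>) (A' i) - measure C (A' i)) *\<^sub>R c i)"
      by (rule sum.cong) (auto simp: A'_def)
    also have "\<dots> = ?D \<omega> + ?Q \<omega>"
      by (simp add: d_def scaleR_diff_right sum_subtractf)
    finally show ?thesis .
  qed
  show ?thesis
  \<comment> \<open>If all balls around points of \<open>Q\<close> were null, \<open>X\<close> would
    almost surely stay \<open>4 * e\<close> away from \<open>?Q\<close>. Outside \<open>E1\<close>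
    and \<open>E2\<close>, whose probabilities add up to less than 1, it is within
    \<open>3 * e\<close>.\<close>
  proof (rule ccontr)
    assume "\<not> ?thesis"
    then have z: "prob {\<omega>\<in>space M. norm (X \<omega> - q) < 4 * e} = 0" if "q \<in> Q" for q
      using that QV by (metis measure_nonneg order_le_less subsetD)
    have ms: "{\<omega>\<in>space M. norm (X \<omega> - q) < 4 * e} \<in> sets M" for q
      by (intro borel_measurable_less measurable_norm_diff_const X borel_measurable_const)
    have "AE \<omega> in M. \<forall>q\<in>Q. \<not> norm (X \<omega> - q) < 4 * e"
    proof (subst AE_ball_countable[OF Qc], rule ballI)
      fix q assume "q \<in> Q"
      then have "emeasure M {\<omega>\<in>space M. norm (X \<omega> - q) < 4 * e} = 0" by (simp add: emeasure_eq_measure z)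
      then show "AE \<omega> in M. \<not> norm (X \<omega> - q) < 4 * e" by (intro AE_I[OF _ _ ms]) auto
    qed
    define E1 where "E1 = {\<omega>\<in>space M. norm (cint (\<phi> n) \<omega> - X \<omega>) > e}"
    define E2 where "E2 = {\<omega>\<in>space M. norm (?D \<omega>) > 2 * e}"
    have sets: "E1 \<in> sets M" "E2 \<in> sets M"
    proof -
      show "E1 \<in> sets M" unfolding E1_def
        by (intro borel_measurable_less measurable_norm_cint_diff \<phi> X borel_measurable_const)
      have "(\<lambda>\<omega>. norm (?D \<omega> - 0)) \<in> borel_measurable M"
        by (intro borel_measurable_norm_sum_diff borel_measurable_diff measurable_measure_\<eta> A's measurable_const) simp_all
      then show "E2 \<in> sets M" unfolding E2_def
        by (intro borel_measurable_less borel_measurable_const) simp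
    qed
    have "AE \<omega> in M. \<omega> \<in> E1 \<union> E2"
      using \<open>AE \<omega> in M. \<forall>q\<in>Q. \<not> norm (X \<omega> - q) < 4 * e\<close> QAE AE_space
    proof eventually_elim
      case (elim \<omega>)
      show ?case
      proof (rule ccontr)
        assume "\<omega> \<notin> E1 \<union> E2"
        then have "norm (cint (\<phi> n) \<omega> - X \<omega>) \<le> e" "norm (?D \<omega>) \<le> 2 * e"
          using elim by (auto simp: E1_def E2_def)
        moreover have "X \<omega> - ?Q \<omega> = ?D \<omega> - (cint (\<phi> n) \<omega> - X \<omega>)" using cintD[OF elim(3)] by simp
        then have "norm (X \<omega> - ?Q \<omega>) = norm (?D \<omega> - (cint (\<phi> n) \<omega> - X \<omega>))" by (rule arg_cong)
        then have "norm (X \<omega> - ?Q \<omega>) \<le> norm (?D \<omega>) + norm (cint (\<phi> n) \<omega> - X \<omega>)"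
          using norm_triangle_ineq4[of "?D \<omega>" "cint (\<phi> n) \<omega> - X \<omega>"] by linarith
        ultimately have "norm (X \<omega> - ?Q \<omega>) < 4 * e" using e by linarith
        then show False using elim by blast
      qed
    qed
    then have "1 = prob (E1 \<union> E2)" using sets by (subst (asm) AE_in_set_eq_1) auto
    also have "\<dots> \<le> prob E1 + prob E2" using sets by (rule measure_Un_le)
    also have "\<dots> < 1" using n(1) small s(3) unfolding E1_def E2_def by linarith
    finally show False by simp
  qed
qed

section \<open>Translations preserving the support of the law\<close>

text \<open>Such \<open>h\<close> map the support of the law into itself. Balls are used instead of
  support points because \<open>exists_prob_ball_pos\<close> yields a centre for each radius, not
  one centre for all radii. The increase from \<open>r\<close> to \<open>r'\<close> absorbs
  approximation errors and can be divided among several shifts.\<close>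

definition shifts :: "('w \<Rightarrow> 'a::real_normed_vector) \<Rightarrow> 'a set" where
  "shifts X = {h. \<forall>y r r'. r < r' \<longrightarrow> 0 < prob {\<omega>\<in>space M. norm (X \<omega> - y) < r} \<longrightarrow>
     0 < prob {\<omega>\<in>space M. norm (X \<omega> - (y + h)) < r'}}"

lemma shiftsD:
  assumes h: "h \<in> shifts X" and r: "r < r'" and p: "0 < prob {\<omega>\<in>space M. norm (X \<omega> - y) < r}"
  shows "0 < prob {\<omega>\<in>space M. norm (X \<omega> - (y + h)) < r'}"
  using h[unfolded shifts_def mem_Collect_eq, rule_format, OF r p] .

lemma shifts_add:
  assumes "h \<in> shifts X" "g \<in> shifts X"
  shows "h + g \<in> shifts X"
  unfolding shifts_def
proof (intro CollectI allI impI)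
  fix y and r r' :: real
  assume r: "r < r'" and p: "0 < prob {\<omega>\<in>space M. norm (X \<omega> - y) < r}"
  have "0 < prob {\<omega>\<in>space M. norm (X \<omega> - (y + h)) < (r + r') / 2}"
    by (rule shiftsD[OF assms(1) _ p]) (use r in simp)
  from shiftsD[OF assms(2) _ this, of r'] r
  show "0 < prob {\<omega>\<in>space M. norm (X \<omega> - (y + (h + g))) < r'}" by (simp add: add.assoc)
qed

lemma closure_shifts_subset:
  assumes X: "X \<in> borel_measurable M"
  shows "closure (shifts X) \<subseteq> shifts X"
proof
  fix h assume h: "h \<in> closure (shifts X)"
  show "h \<in> shifts X"
    unfolding shifts_def
  proof (intro CollectI allI impI)
    fix y and r r' :: real
    assume r: "r < r'" and p: "0 < prob {\<omega>\<in>space M. norm (X \<omega> - y) < r}"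
    then obtain g where g: "g \<in> shifts X" "dist g h < (r' - r) / 2"
      using h unfolding closure_approachable by (meson diff_gt_0_iff_gt half_gt_zero)
    have "0 < prob {\<omega>\<in>space M. norm (X \<omega> - (y + g)) < (r + r') / 2}"
      by (rule shiftsD[OF g(1) _ p]) (use r in simp)
    also have "\<dots> \<le> prob {\<omega>\<in>space M. norm (X \<omega> - (y + h)) < r'}"
    proof (rule finite_measure_mono)
      show "{\<omega>\<in>space M. norm (X \<omega> - (y + h)) < r'} \<in> sets M"
        by (intro borel_measurable_less measurable_norm_diff_const X borel_measurable_const)
      show "{\<omega>\<in>space M. norm (X \<omega> - (y + g)) < (r + r') / 2} \<subseteq> {\<omega>\<in>space M. norm (X \<omega> - (y + h)) < r'}"
      proof safe
        fix \<omega> assume "norm (X \<omega> - (y + g)) < (r + r') / 2"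
        moreover have "norm (X \<omega> - (y + h)) \<le> norm (X \<omega> - (y + g)) + norm (g - h)"
          using norm_triangle_ineq[of "X \<omega> - (y + g)" "g - h"] by (simp add: diff_diff_eq)
        ultimately show "norm (X \<omega> - (y + h)) < r'" using g(2) unfolding dist_norm by argo
      qed
    qed
    finally show "0 < prob {\<omega>\<in>space M. norm (X \<omega> - (y + h)) < r'}" .
  qed
qed

text \<open>Some ball centred at a point \<open>q\<close> of \<open>V\<close> is charged, and the
  shift \<open>v - q\<close> in \<open>V\<close> moves its centre to \<open>v\<close>. Its radius
  \<open>4 * (e / 8)\<close> is half of \<open>e\<close>, which leaves the room that a shift
  consumes.\<close>

lemma prob_ball_pos_of_shifts:
  fixes X :: "'w \<Rightarrow> 'a::real_inner"
  assumes I: "compensated_integral M \<nu> \<eta> \<Phi> X"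
    and V: "subspace V" "closed V" "AE p in C. \<Phi> p \<in> V" "V \<subseteq> shifts X"
    and v: "v \<in> V" and e: "e > 0"
  shows "0 < prob {\<omega>\<in>space M. norm (X \<omega> - v) < e}"
proof -
  obtain \<phi> where \<phi>: "\<And>n. Bochner_Integration.simple_bochner_integrable C (\<phi> n)"
    "(\<lambda>n. deviation (\<phi> n) \<Phi>) \<longlonglongrightarrow> 0" "converges_in_probability M (\<lambda>n. cint (\<phi> n)) X"
    and X: "X \<in> borel_measurable M"
    using I unfolding compensated_integral_def deviation_def cint_def[abs_def] by blast
  obtain q where q: "q \<in> V" "0 < prob {\<omega>\<in>space M. norm (X \<omega> - q) < 4 * (e / 8)}"
    using exists_prob_ball_pos[OF \<phi> X V(1-3), of "e / 8"] e by auto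
  have "v - q \<in> shifts X" using V v q(1) subspace_diff[of V v q] by blast
  from shiftsD[OF this _ q(2), of e] e show ?thesis by simp
qed

lemma jump_in_shifts:
  fixes X :: "'w \<Rightarrow> 'a::real_inner"
  assumes I: "compensated_integral M \<nu> \<eta> \<Phi> X"
    and jump: "\<And>e. e > 0 \<Longrightarrow> \<exists>G\<in>sets C. 0 < emeasure C G \<and> emeasure C G \<le> ennreal e \<and>
        (AE p in C. p \<in> G \<longrightarrow> norm (\<Phi> p - h) \<le> e)"
  shows "h \<in> shifts X"
proof -
  obtain \<phi> where \<phi>: "\<And>n. Bochner_Integration.simple_bochner_integrable C (\<phi> n)"
    "(\<lambda>n. deviation (\<phi> n) \<Phi>) \<longlonglongrightarrow> 0" "converges_in_probability M (\<lambda>n. cint (\<phi> n)) X"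
    and X: "X \<in> borel_measurable M"
    using I unfolding compensated_integral_def deviation_def cint_def[abs_def] by blast
  show ?thesis
    unfolding shifts_def using prob_translate_pos[OF \<phi> X jump] by blast
qed

end

section \<open>Step approximation of a control\<close>

lemma L2_on_integrable:
  assumes "L2_on T v"
  shows "integrable (lebesgue_on {0..T}) v"
proof (rule Bochner_Integration.integrable_bound)
  have "finite_measure (lebesgue_on {0..T})"
    by (rule finite_measure_lebesgue_on) auto
  then interpret finite_measure "lebesgue_on {0..T}" .
  show "integrable (lebesgue_on {0..T}) (\<lambda>s. 1 + (v s)\<^sup>2)"
    using assms by (auto simp: L2_on_def)
  show "v \<in> borel_measurable (lebesgue_on {0..T})" using assms by (simp add: L2_on_def)
  have "\<bar>x\<bar> \<le> 1 + x\<^sup>2" for x :: real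
  proof -
    have "0 \<le> (\<bar>x\<bar> - 1)\<^sup>2" by simp
    then have "2 * \<bar>x\<bar> \<le> 1 + x\<^sup>2" by (simp add: power2_diff)
    then show ?thesis using abs_ge_zero[of x] by linarith
  qed
  then show "AE s in lebesgue_on {0..T}. norm (v s) \<le> norm (1 + (v s)\<^sup>2)" by (simp add: abs_of_nonneg add_nonneg_nonneg)
qed

lemma integrable_on_indicator_times:
  fixes v :: "real \<Rightarrow> real"
  assumes v: "integrable (lebesgue_on {0..T}) v" and B: "B \<in> sets borel"
  shows "(\<lambda>s. indicator B s * v s) integrable_on {0..T}"
proof (rule integrable_on_lebesgue_on)
  have "{0..T} \<inter> B \<in> sets (lebesgue_on {0..T})"
    using B by (auto simp: sets_restrict_space)
  then have "integrable (lebesgue_on {0..T}) (\<lambda>s. indicator ({0..T} \<inter> B) s *\<^sub>R v s)"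
    using v by (rule integrable_mult_indicator)
  then show "integrable (lebesgue_on {0..T}) (\<lambda>s. indicator B s * v s)"
    by (rule Bochner_Integration.integrable_cong[THEN iffD1, rotated 2]) (auto simp: indicator_def)
qed simp

definition grid :: "real \<Rightarrow> nat \<Rightarrow> real \<Rightarrow> real" where
  "grid T n s = T / real (Suc n) * real_of_int \<lfloor>s * real (Suc n) / T\<rfloor>"

lemma grid_bounds:
  assumes "T > 0"
  shows "grid T n s \<le> s" "s - T / real (Suc n) < grid T n s" "s \<ge> 0 \<Longrightarrow> 0 \<le> grid T n s"
proof -
  let ?N = "real (Suc n)" and ?x = "s * real (Suc n) / T"
  have N: "T / ?N > 0" using assms by simp
  have s: "T / ?N * ?x = s" using assms by simp
  have "T / ?N * of_int \<lfloor>?x\<rfloor> \<le> T / ?N * ?x"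
    using N by (intro mult_left_mono) auto
  then show "grid T n s \<le> s" by (simp only: s grid_def)
  have "T / ?N * (?x - 1) < T / ?N * of_int \<lfloor>?x\<rfloor>"
    using N by (intro mult_strict_left_mono) linarith+
  moreover have "T / ?N * (?x - 1) = s - T / ?N" by (simp only: right_diff_distrib s mult_1_right)
  ultimately show "s - T / ?N < grid T n s" by (simp only: grid_def)
  show "0 \<le> grid T n s" if "s \<ge> 0"
    using that assms by (simp add: grid_def)
qed

text \<open>The weights are integrals of \<open>v\<close> over the level sets of
  \<open>grid\<close>. The index \<open>Suc n\<close> accounts for the endpoint
  \<open>s = T\<close>. The function \<open>f\<close> is arbitrary, so that a truncated, possibly
  discontinuous orbit can be inserted.\<close>

lemma has_integral_step:
  fixes f :: "real \<Rightarrow> 'a::real_normed_vector"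
  assumes T: "T > 0" and v: "integrable (lebesgue_on {0..T}) v"
  shows "\<exists>w. ((\<lambda>s. v s *\<^sub>R f (grid T n s)) has_integral (\<Sum>i\<le>Suc n. w i *\<^sub>R f (T / real (Suc n) * real i))) {0..T}"
proof -
  let ?N = "real (Suc n)"
  define Bi where "Bi i = {s. \<lfloor>s * ?N / T\<rfloor> = int i}" for i :: nat
  have B: "Bi i \<in> sets borel" for i
  proof -
    have "(\<lambda>s. \<lfloor>s * ?N / T\<rfloor>) -` {int i} \<inter> space borel \<in> sets (borel :: real measure)"
      by (rule measurable_sets[of _ _ "count_space UNIV"]) measurable
    moreover have "(\<lambda>s. \<lfloor>s * ?N / T\<rfloor>) -` {int i} \<inter> space borel = Bi i" by (auto simp: Bi_def)
    ultimately show ?thesis by simp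
  qed
  define w where "w i = integral {0..T} (\<lambda>s. indicator (Bi i) s * v s)" for i
  have "((\<lambda>s. indicator (Bi i) s * v s) has_integral w i) {0..T}" for i
    unfolding w_def by (rule integrable_integral[OF integrable_on_indicator_times[OF v B]])
  then have "((\<lambda>s. \<Sum>i\<le>Suc n. (indicator (Bi i) s * v s) *\<^sub>R f (T / ?N * real i)) has_integral
      (\<Sum>i\<le>Suc n. w i *\<^sub>R f (T / ?N * real i))) {0..T}"
    by (intro has_integral_sum has_integral_scaleR_left) auto
  then have "((\<lambda>s. v s *\<^sub>R f (grid T n s)) has_integral (\<Sum>i\<le>Suc n. w i *\<^sub>R f (T / ?N * real i))) {0..T}"
  proof (rule has_integral_eq[rotated])
    fix s assume s: "s \<in> {0..T}"
    let ?x = "\<lfloor>s * ?N / T\<rfloor>"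
    have x: "0 \<le> ?x" using s T by simp
    have "s * ?N / T \<le> ?N" using s T by (simp add: pos_divide_le_eq mult.commute mult_right_mono)
    then have x2: "?x \<le> int (Suc n)" by linarith
    have "(\<Sum>i\<le>Suc n. (indicator (Bi i) s * v s) *\<^sub>R f (T / ?N * real i))
        = (\<Sum>i\<le>Suc n. if i = nat ?x then v s *\<^sub>R f (T / ?N * real i) else 0)"
      by (rule sum.cong) (use x in \<open>auto simp: Bi_def indicator_def\<close>)
    also have "\<dots> = v s *\<^sub>R f (T / ?N * real (nat ?x))" using x2 by (subst sum.delta) auto
    also have "\<dots> = v s *\<^sub>R f (grid T n s)" using x by (simp add: grid_def)
    finally show "(\<Sum>i\<le>Suc n. (indicator (Bi i) s * v s) *\<^sub>R f (T / ?N * real i)) = v s *\<^sub>R f (grid T n s)" .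
  qed
  then show ?thesis by blast
qed

section \<open>The control acts inside the span of the orbit\<close>

lemma grid_uniform_tendsto:
  fixes f :: "real \<Rightarrow> 'a::metric_space"
  assumes f: "continuous_on {0..T} f" and T: "T > 0" and e: "e > 0"
  shows "\<exists>n0. \<forall>n\<ge>n0. \<forall>s\<in>{0..T}. dist (f (grid T n s)) (f s) < e"
proof -
  have "uniformly_continuous_on {0..T} f"
    using f by (rule compact_uniformly_continuous) simp
  then obtain d where d: "d > 0" "\<And>s t. s \<in> {0..T} \<Longrightarrow> t \<in> {0..T} \<Longrightarrow> dist t s < d \<Longrightarrow> dist (f t) (f s) < e"
    unfolding uniformly_continuous_on_def using e by metis
  obtain n0 where n0: "T / d < real (Suc n0)"
    using reals_Archimedean2[of "T / d"] by (metis less_Suc_eq of_nat_less_iff less_trans)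
  show ?thesis
  proof (intro exI allI impI ballI)
    fix n s assume n: "n \<ge> n0" and s: "s \<in> {0..T}"
    have "T / d < real (Suc n)" using n0 n by (meson less_le_trans of_nat_mono Suc_le_mono)
    then have "T / real (Suc n) < d" using d(1) T by (simp add: pos_divide_less_eq mult.commute)
    then show "dist (f (grid T n s)) (f s) < e"
      using d(2)[OF s, of "grid T n s"] grid_bounds[OF T, where n = n and s = s] s by (auto simp: dist_real_def)
  qed
qed

text \<open>The integral defining \<open>h\<close> is taken in the extrapolation space, yet
  convergence holds in the Hilbert norm: uniform continuity of \<open>f\<close> makes
  \<open>q\<close> Cauchy there, and \<open>j\<close>, continuous and injective, identifies the
  limit.\<close>

lemma step_integrals_tendsto:
  fixes f :: "real \<Rightarrow> 'a::{real_inner,complete_space}" and j :: "'a \<Rightarrow> 'e::banach"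
  assumes f: "continuous_on {0..T} f" and T: "T > 0" and v: "integrable (lebesgue_on {0..T}) v"
    and j: "bounded_linear j" "inj j"
    and h: "((\<lambda>s. v s *\<^sub>R j (f s)) has_integral j h) {0..T}"
    and q: "\<And>n. ((\<lambda>s. v s *\<^sub>R f (grid T n s)) has_integral q n) {0..T}"
  shows "q \<longlonglongrightarrow> h"
proof -
  interpret j: bounded_linear j by fact
  have va: "integrable (lebesgue_on {0..T}) (\<lambda>s. \<bar>v s\<bar>)" using v by simp
  have vi: "(\<lambda>s. \<bar>v s\<bar>) integrable_on {0..T}"
    by (rule integrable_on_lebesgue_on[OF va]) simp
  define I where "I = integral {0..T} (\<lambda>s. \<bar>v s\<bar>)"
  have I: "I \<ge> 0" unfolding I_def by (rule integral_nonneg[OF vi]) simp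
  have "Cauchy q"
  proof (rule metric_CauchyI)
    fix e :: real assume e: "e > 0"
    \<comment> \<open>The added 1 covers the case that \<open>v\<close> has integral norm 0.\<close>
    define d where "d = e / (2 * (I + 1))"
    have d: "d > 0" "2 * d * I < e" using e I by (auto simp: d_def field_simps)
    obtain n0 where n0: "\<forall>n\<ge>n0. \<forall>s\<in>{0..T}. dist (f (grid T n s)) (f s) < d"
      using grid_uniform_tendsto[OF f T d(1)] by blast
    show "\<exists>N. \<forall>m\<ge>N. \<forall>n\<ge>N. dist (q m) (q n) < e"
    proof (intro exI allI impI)
      fix m n assume mn: "n0 \<le> m" "n0 \<le> n"
      have qd: "((\<lambda>s. v s *\<^sub>R f (grid T m s) - v s *\<^sub>R f (grid T n s)) has_integral (q m - q n)) {0..T}"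
        by (rule has_integral_diff[OF q q])
      have "norm (q m - q n) \<le> integral {0..T} (\<lambda>s. \<bar>v s\<bar> * (2 * d))"
        unfolding integral_unique[OF qd, symmetric]
      proof (rule norm_integral_le_dominated)
        fix s assume s: "s \<in> {0..T}"
        have "dist (f (grid T m s)) (f (grid T n s)) \<le> 2 * d"
          using n0[rule_format, OF mn(1) s] n0[rule_format, OF mn(2) s]
            dist_triangle2[of "f (grid T m s)" "f (grid T n s)" "f s"] by linarith
        then show "norm (v s *\<^sub>R f (grid T m s) - v s *\<^sub>R f (grid T n s)) \<le> \<bar>v s\<bar> * (2 * d)"
          by (simp add: dist_norm mult_left_mono flip: scaleR_diff_right)
      qed (use qd vi in \<open>auto intro!: integrable_on_mult_left\<close>)
      also have "\<dots> = 2 * d * I" by (simp add: I_def)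
      finally show "dist (q m) (q n) < e" using d(2) by (simp add: dist_norm)
    qed
  qed
  then obtain p where p: "q \<longlonglongrightarrow> p" using Cauchy_convergent convergent_def by blast
  have "(\<lambda>n. j (q n)) \<longlonglongrightarrow> j h"
  proof (rule LIMSEQ_I)
    fix e :: real assume e: "e > 0"
    define d where "d = e / (2 * (I + 1))"
    have d: "d > 0" "d * I < e" using e I by (auto simp: d_def field_simps intro: add_nonneg_pos)
    have jf: "continuous_on {0..T} (\<lambda>s. j (f s))" by (rule j.continuous_on[OF f])
    obtain n0 where n0: "\<forall>n\<ge>n0. \<forall>s\<in>{0..T}. dist (j (f (grid T n s))) (j (f s)) < d"
      using grid_uniform_tendsto[OF jf T d(1)] by blast
    show "\<exists>n0. \<forall>n\<ge>n0. norm (j (q n) - j h) < e"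
    proof (intro exI allI impI)
      fix n assume n: "n \<ge> n0"
      have "((j \<circ> (\<lambda>s. v s *\<^sub>R f (grid T n s))) has_integral j (q n)) {0..T}"
        by (rule has_integral_linear[OF q j(1)])
      then have "((\<lambda>s. v s *\<^sub>R j (f (grid T n s))) has_integral j (q n)) {0..T}"
        by (simp add: o_def j.scaleR)
      from has_integral_diff[OF this h]
      have qd: "((\<lambda>s. v s *\<^sub>R j (f (grid T n s)) - v s *\<^sub>R j (f s)) has_integral (j (q n) - j h)) {0..T}" .
      have "norm (j (q n) - j h) \<le> integral {0..T} (\<lambda>s. \<bar>v s\<bar> * d)"
        unfolding integral_unique[OF qd, symmetric]
      proof (rule Henstock_Kurzweil_Integration.integral_norm_bound_integral)
        fix s assume s: "s \<in> {0..T}"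
        have "dist (j (f (grid T n s))) (j (f s)) \<le> d"
          using n0[rule_format, OF n s] by simp
        then show "norm (v s *\<^sub>R j (f (grid T n s)) - v s *\<^sub>R j (f s)) \<le> \<bar>v s\<bar> * d"
          by (simp add: dist_norm mult_left_mono flip: scaleR_diff_right)
      qed (use qd vi in \<open>auto intro!: integrable_on_mult_left\<close>)
      also have "\<dots> = d * I" by (simp add: I_def)
      finally show "norm (j (q n) - j h) < e" using d(2) by simp
    qed
  qed
  from LIMSEQ_unique[OF j.tendsto[OF p] this] have "p = h" using j(2) by (simp add: inj_eq)
  with p show ?thesis by simp
qed

text \<open>The orbit \<open>g\<close> may be too singular at \<open>0\<close> for \<open>v s *\<^sub>R g (T - s)\<close> to be integrable in the
  Hilbert space. Applying \<open>S r\<close> first regularises it; this moves part of the orbit beyond time \<open>T\<close>,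
  but the corresponding part of the integral vanishes as \<open>r\<close> tends to \<open>0\<close>.\<close>

lemma control_integral_in_orbit_span:
  fixes S :: "real \<Rightarrow> 'a::{real_inner,complete_space} \<Rightarrow> 'a" and j :: "'a \<Rightarrow> 'e::banach"
  assumes S: "strongly_continuous_semigroup S" and T: "T > 0" and v: "integrable (lebesgue_on {0..T}) v"
    and j: "bounded_linear j" "inj j"
    and SE: "\<And>t. t \<ge> 0 \<Longrightarrow> bounded_linear (SE t)" "\<And>t x. t \<ge> 0 \<Longrightarrow> SE t (j x) = j (S t x)"
      "\<And>s t y. s \<ge> 0 \<Longrightarrow> t \<ge> 0 \<Longrightarrow> SE (s + t) y = SE s (SE t y)"
    and g: "\<And>t. t > 0 \<Longrightarrow> j (g t) = SE t b" "continuous_on {0<..} g"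
      "\<And>r t. r \<ge> 0 \<Longrightarrow> t > 0 \<Longrightarrow> g (r + t) = S r (g t)"
    and h: "((\<lambda>s. SE (T - s) (v s *\<^sub>R b)) has_integral j h) {0..T}"
  shows "h \<in> closure (span (g ` {0<..<T}))"
proof -
  have "compact (g ` {T..T + 1})"
    by (rule compact_continuous_image) (use T in \<open>auto intro: continuous_on_subset[OF g(2)]\<close>)
  then have "\<exists>G0. \<forall>x\<in>g ` {T..T + 1}. norm x \<le> G0"
    using compact_imp_bounded bounded_iff by blast
  then obtain G0 where G0: "\<And>t. t \<in> {T..T + 1} \<Longrightarrow> norm (g t) \<le> G0"
    by blast
  \<comment> \<open>A bound for the part of the regularised orbit beyond time
    \<open>T\<close>.\<close>
  define G where "G = \<bar>G0\<bar> + 1"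
  have G: "G > 0" "\<And>t. t \<in> {T..T + 1} \<Longrightarrow> norm (g t) \<le> G"
    using G0 by (fastforce simp: G_def)+
  have va: "integrable (lebesgue_on {0..T}) (\<lambda>s. \<bar>v s\<bar>)" using v by simp
  have vi: "(\<lambda>s. \<bar>v s\<bar>) integrable_on {0..T}"
    by (rule integrable_on_lebesgue_on[OF va]) simp
  define W where "W a = integral {0..a} (\<lambda>s. \<bar>v s\<bar>)" for a
  have Wcont: "continuous_on {0..T} W"
    unfolding W_def by (rule indefinite_integral_continuous_1[OF vi])
  have W0: "W 0 = 0" by (simp add: W_def)
  have close: "infdist (S r h) (span (g ` {0<..<T})) \<le> G * W (2 * r)" if r: "0 < r" "r \<le> 1" "2 * r \<le> T" for r
  proof -
    \<comment> \<open>Since \<open>r > 0\<close>, the argument of \<open>g\<close> stays away from 0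
      and \<open>f\<close> is continuous up to \<open>s = T\<close>.\<close>
    define f where "f s = g (r + (T - s))" for s
    have f: "continuous_on {0..T} f"
      unfolding f_def using r by (auto intro!: continuous_on_compose2[OF g(2)] continuous_intros)
    have jf: "SE r (SE (T - s) (v s *\<^sub>R b)) = v s *\<^sub>R j (f s)" if "s \<in> {0..T}" for s
    proof -
      have "SE r (SE (T - s) (v s *\<^sub>R b)) = SE (r + (T - s)) (v s *\<^sub>R b)" using r that by (simp add: SE(3))
      also have "\<dots> = v s *\<^sub>R SE (r + (T - s)) b" using r that by (intro linear_simps SE(1)) auto
      finally show ?thesis using r that by (simp add: f_def g(1))
    qed
    have "((SE r \<circ> (\<lambda>s. SE (T - s) (v s *\<^sub>R b))) has_integral SE r (j h)) {0..T}"
      by (rule has_integral_linear[OF h SE(1)]) (use r in simp)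
    then have h': "((\<lambda>s. v s *\<^sub>R j (f s)) has_integral j (S r h)) {0..T}"
      using r by (subst (asm) SE(2)) (auto elim!: has_integral_eq[rotated] simp: jf)
    \<comment> \<open>For \<open>s \<le> r\<close> the value \<open>f s\<close> lies on the orbit at
      time \<open>T\<close> or later, outside the generators of the span, and is replaced by
      0.\<close>
    define k where "k s = (if s > r then f s else 0)" for s
    obtain w where q: "((\<lambda>s. v s *\<^sub>R f (grid T n s)) has_integral (\<Sum>i\<le>Suc n. w n i *\<^sub>R f (T / real (Suc n) * real i))) {0..T}" for n
      using has_integral_step[OF T v, of f] by metis
    define q where "q n = (\<Sum>i\<le>Suc n. w n i *\<^sub>R f (T / real (Suc n) * real i))" for n
    have qlim: "q \<longlonglongrightarrow> S r h"
      by (rule step_integrals_tendsto[OF f T v j h']) (use q in \<open>simp add: q_def\<close>)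
    obtain w' where p: "((\<lambda>s. v s *\<^sub>R k (grid T n s)) has_integral (\<Sum>i\<le>Suc n. w' n i *\<^sub>R k (T / real (Suc n) * real i))) {0..T}" for n
      using has_integral_step[OF T v, of k] by metis
    define p where "p n = (\<Sum>i\<le>Suc n. w' n i *\<^sub>R k (T / real (Suc n) * real i))" for n
    have kspan: "k s \<in> span (g ` {0<..<T})" if "s \<le> T" for s
      using that r by (auto simp: k_def f_def intro!: span_base span_0)
    have pV: "p n \<in> span (g ` {0<..<T})" for n
      unfolding p_def
    proof (intro span_sum span_scale kspan)
      fix i assume "i \<in> {..Suc n}"
      then have "real i \<le> real (Suc n)" by simp
      then show "T / real (Suc n) * real i \<le> T" using T by (simp add: pos_divide_le_eq mult_left_mono)
    qed
    \<comment> \<open>Once the mesh is below \<open>r\<close>, truncation at a grid point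
      \<open>\<le> r\<close> affects only \<open>s < 2 * r\<close>; hence the argument of
      \<open>W\<close>.\<close>
    obtain n0 where n0: "T / r < real (Suc n0)"
      using reals_Archimedean2[of "T / r"] by (metis less_Suc_eq of_nat_less_iff less_trans)
    have qp: "norm (q n - p n) \<le> G * W (2 * r)" if n: "n \<ge> n0" for n
    proof -
      have "T / r < real (Suc n)" using n0 n by (meson less_le_trans of_nat_mono Suc_le_mono)
      then have Tn: "T / real (Suc n) < r" using r T by (simp add: pos_divide_less_eq mult.commute)
      have d: "((\<lambda>s. v s *\<^sub>R f (grid T n s) - v s *\<^sub>R k (grid T n s)) has_integral (q n - p n)) {0..T}"
        unfolding q_def p_def by (rule has_integral_diff[OF q p])
      have ind: "(\<lambda>s. indicator {0..2 * r} s * \<bar>v s\<bar>) integrable_on {0..T}"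
        by (rule integrable_on_indicator_times[OF va]) simp
      have "norm (q n - p n) \<le> integral {0..T} (\<lambda>s. G * (indicator {0..2 * r} s * \<bar>v s\<bar>))"
        unfolding integral_unique[OF d, symmetric]
      proof (rule norm_integral_le_dominated)
        fix s assume s: "s \<in> {0..T}"
        show "norm (v s *\<^sub>R f (grid T n s) - v s *\<^sub>R k (grid T n s)) \<le> G * (indicator {0..2 * r} s * \<bar>v s\<bar>)"
        proof (cases "grid T n s > r")
          case False
          have gb: "grid T n s \<le> s" "s - T / real (Suc n) < grid T n s" "0 \<le> grid T n s"
            using grid_bounds[OF T, where n = n and s = s] s by auto
          then have "norm (f (grid T n s)) \<le> G"
            using False r unfolding f_def by (intro G(2)) auto
          moreover have "s \<in> {0..2 * r}" using gb False Tn s by auto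
          ultimately show ?thesis
            using False mult_right_mono[of "norm (f (grid T n s))" G "\<bar>v s\<bar>"] by (simp add: k_def mult.commute)
        qed (use G in \<open>simp add: k_def\<close>)
      qed (use d ind in \<open>auto intro!: integrable_on_mult_right\<close>)
      also have "\<dots> = G * integral {0..T} (\<lambda>s. indicator {0..2 * r} s * \<bar>v s\<bar>)" by simp
      also have "integral {0..T} (\<lambda>s. indicator {0..2 * r} s * \<bar>v s\<bar>) = W (2 * r)"
      proof -
        have "integral {0..T} (\<lambda>s. indicator {0..2 * r} s * \<bar>v s\<bar>)
            = integral {0..T} (\<lambda>s. if s \<in> {0..2 * r} then \<bar>v s\<bar> else 0)"
          by (rule integral_cong) (simp add: indicator_def)
        also have "\<dots> = integral ({0..2 * r} \<inter> {0..T}) (\<lambda>s. \<bar>v s\<bar>)" by (rule integral_restrict_Int)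
        also have "{0..2 * r} \<inter> {0..T} = {0..2 * r}" using r by auto
        finally show ?thesis by (simp add: W_def)
      qed
      finally show ?thesis .
    qed
    have "infdist (q n) (span (g ` {0<..<T})) \<le> G * W (2 * r)" if "n \<ge> n0" for n
      using infdist_le[OF pV, of "q n" n] qp[OF that] by (simp add: dist_norm)
    moreover have "(\<lambda>n. infdist (q n) (span (g ` {0<..<T}))) \<longlonglongrightarrow> infdist (S r h) (span (g ` {0<..<T}))"
      by (intro tendsto_infdist qlim)
    ultimately show ?thesis by (intro LIMSEQ_le_const2) auto
  qed
  have "continuous_on {0..} (\<lambda>t. S t h)" and S0: "S 0 h = h"
    using S by (auto simp: strongly_continuous_semigroup_def)
  then have "((\<lambda>t. S t h) \<longlongrightarrow> h) (at 0 within {0..})"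
    using continuous_on_def[of "{0..}" "\<lambda>t. S t h"] by force
  then have Slim: "((\<lambda>t. S t h) \<longlongrightarrow> h) (at_right 0)"
    by (rule tendsto_within_subset) auto
  have "(W \<longlongrightarrow> 0) (at 0 within {0..T})"
    using Wcont T W0 unfolding continuous_on_def by force
  then have "(W \<longlongrightarrow> 0) (at_right 0)"
    using T by (simp add: at_within_Icc_at_right)
  moreover have "filterlim (\<lambda>r::real. 2 * r) (at_right 0) (at_right 0)" by real_asymp
  ultimately have "((\<lambda>r. W (2 * r)) \<longlongrightarrow> 0) (at_right 0)" by (rule filterlim_compose)
  from tendsto_mult_left[OF this, of G] have lim: "((\<lambda>r. G * W (2 * r)) \<longlongrightarrow> 0) (at_right 0)" by simp
  have ev: "\<forall>\<^sub>F r in at_right 0. infdist (S r h) (span (g ` {0<..<T})) \<le> G * W (2 * r)"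
    unfolding eventually_at_right_field
    by (rule exI[of _ "min 1 (T / 2)"]) (use T in \<open>auto intro!: close\<close>)
  \<comment> \<open>As \<open>r\<close> tends to 0, \<open>S r h\<close> tends to \<open>h\<close>
    and the truncation error \<open>G * W (2 * r)\<close> to 0.\<close>
  have "infdist h (span (g ` {0<..<T})) \<le> 0"
    by (rule tendsto_le[OF _ lim tendsto_infdist[OF Slim] ev]) simp
  then have "infdist h (span (g ` {0<..<T})) = 0" using infdist_nonneg[of h "span (g ` {0<..<T})"] by simp
  then show ?thesis using in_closure_iff_infdist_zero[of "span (g ` {0<..<T})" h] span_0 by blast
qed

section \<open>The orbit of the noise coefficient\<close>

lemma closure_span_subspace: "subspace (closure (span A :: 'a::real_normed_vector set))"
  unfolding subspace_def
proof (intro conjI ballI allI)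
  show "0 \<in> closure (span A)" using closure_subset span_0 by blast
next
  fix x y assume "x \<in> closure (span A)" "y \<in> closure (span A)"
  then obtain p q where "\<And>n. p n \<in> span A" "p \<longlonglongrightarrow> x" "\<And>n. q n \<in> span A" "q \<longlonglongrightarrow> y"
    unfolding closure_sequential by blast
  then show "x + y \<in> closure (span A)"
    unfolding closure_sequential by (intro exI[of _ "\<lambda>n. p n + q n"]) (auto intro!: span_add tendsto_add)
next
  fix c x assume "x \<in> closure (span A)"
  then obtain p where "\<And>n. p n \<in> span A" "p \<longlonglongrightarrow> x"
    unfolding closure_sequential by blast
  then show "c *\<^sub>R x \<in> closure (span A)"
    unfolding closure_sequential by (intro exI[of _ "\<lambda>n. c *\<^sub>R p n"]) (auto intro!: span_scale tendsto_scaleR)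
qed

text \<open>Both sides are continuous in \<open>y\<close> and agree on the dense range of
  \<open>j\<close>.\<close>

lemma extended_semigroup_add:
  assumes S: "strongly_continuous_semigroup S" and SE: "extended_semigroup S j SE"
    and dense: "closure (range j) = UNIV" and st: "s \<ge> 0" "t \<ge> 0"
  shows "SE (s + t) y = SE s (SE t y)"
proof -
  have bl: "bounded_linear (SE r)" "SE r (j x) = j (S r x)" if "r \<ge> 0" for r x
    using SE that by (auto simp: extended_semigroup_def)
  let ?E = "{y. SE (s + t) y = SE s (SE t y)}"
  have "closed ?E"
    using st by (intro closed_Collect_eq linear_continuous_on bl(1) bounded_linear_compose[OF bl(1) bl(1)]) auto
  moreover have "range j \<subseteq> ?E"
    using S st by (auto simp: bl strongly_continuous_semigroup_def)
  ultimately have "closure (range j) \<subseteq> ?E" by (rule closure_minimal[rotated])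
  then show ?thesis using dense by auto
qed

section \<open>Intensities of rectangles of jump sizes and times\<close>

lemma emeasure_compensator_Times:
  assumes U: "U \<in> sets \<nu>" and W: "W \<in> sets borel"
  shows "emeasure (compensator \<nu>) (U \<times> W) = emeasure \<nu> U * emeasure lborel (W \<inter> {0..})"
proof -
  let ?L = "density lborel (indicator {0::real..} :: real \<Rightarrow> ennreal)"
  have "sigma_finite_measure ?L"
    by (rule sigma_finite_measure.sigma_finite_iff_density_finite[OF lborel.sigma_finite_measure_axioms, THEN iffD2]) (auto simp: indicator_def)
  then interpret L: sigma_finite_measure ?L .
  have "emeasure ?L W = (\<integral>\<^sup>+x. indicator {0..} x * indicator W x \<partial>lborel)"
    using W by (intro emeasure_density) auto
  also have "\<dots> = (\<integral>\<^sup>+x. indicator (W \<inter> {0..}) x \<partial>lborel)"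
    by (rule nn_integral_cong) (auto split: split_indicator)
  also have "\<dots> = emeasure lborel (W \<inter> {0..})" using W by (intro nn_integral_indicator) auto
  finally have "emeasure ?L W = emeasure lborel (W \<inter> {0..})" .
  then show ?thesis
    using L.emeasure_pair_measure_Times[of U \<nu> W] U W by (simp add: compensator_def)
qed

text \<open>Serves to discard the jump times \<open>T\<close>, where the integrand would involve the
  undetermined value \<open>g 0\<close>, and 0, where it involves \<open>g T\<close> rather than a
  generator of \<open>V\<close>.\<close>

lemma AE_compensator_time_neq: "AE p in compensator \<nu>. snd p \<noteq> (c::real)"
proof -
  have m: "space \<nu> \<times> {c} \<in> sets (compensator \<nu>)" unfolding compensator_def by auto
  have "emeasure lborel ({c} \<inter> {0..}) \<le> emeasure lborel {c}" by (rule emeasure_mono) auto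
  then have "emeasure (compensator \<nu>) (space \<nu> \<times> {c}) = 0"
    by (subst emeasure_compensator_Times) auto
  then show ?thesis
    by (intro AE_I[OF _ _ m]) (auto simp: compensator_def space_pair_measure)
qed

text \<open>The interval stays in the tail, where the density lies between its values at modulus
  \<open>\<bar>z\<bar> + d\<close> and \<open>r0\<close>. Positivity lets such jumps occur; the
  upper bound makes their intensity shrink with \<open>d\<close>.\<close>

lemma emeasure_tail_interval:
  fixes k :: "real \<Rightarrow> real"
  assumes k: "k \<in> borel_measurable borel" and \<nu>: "\<nu> = density lborel (\<lambda>r. ennreal (k r))"
    and tail: "\<And>r. \<bar>r\<bar> \<ge> r0 \<Longrightarrow> k r = K0 * \<bar>r\<bar> powr (- \<alpha> - 1)"
    and a: "1 < \<alpha>" "K0 > 0" "r0 > 0" and d: "d > 0" and z: "r0 + d \<le> \<bar>z\<bar>"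
  shows "0 < emeasure \<nu> {z - d..z + d}"
    "emeasure \<nu> {z - d..z + d} \<le> ennreal (K0 * r0 powr (- \<alpha> - 1) * (2 * d))"
proof -
  let ?U = "{z - d..z + d}"
  have U: "\<bar>r\<bar> \<ge> r0" "\<bar>r\<bar> \<le> \<bar>z\<bar> + d" if "r \<in> ?U" for r using that z by auto
  have e: "emeasure \<nu> ?U = (\<integral>\<^sup>+r. ennreal (k r) * indicator ?U r \<partial>lborel)"
    using k by (simp add: \<nu> emeasure_density)
  let ?l = "K0 * (\<bar>z\<bar> + d) powr (- \<alpha> - 1)" and ?u = "K0 * r0 powr (- \<alpha> - 1)"
  have ce: "(\<integral>\<^sup>+r. ennreal x * indicator ?U r \<partial>lborel) = ennreal (x * (2 * d))" if "x \<ge> 0" for x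
    using d that by (simp add: nn_integral_cmult_indicator ennreal_mult' algebra_simps)
  have "(\<integral>\<^sup>+r. ennreal ?l * indicator ?U r \<partial>lborel) \<le> emeasure \<nu> ?U"
    unfolding e
  proof (rule nn_integral_mono)
    fix r
    show "ennreal ?l * indicator ?U r \<le> ennreal (k r) * indicator ?U r"
    proof (cases "r \<in> ?U")
      case True
      then have "(\<bar>z\<bar> + d) powr (- \<alpha> - 1) \<le> \<bar>r\<bar> powr (- \<alpha> - 1)"
        using U[OF True] a by (intro powr_mono2') auto
      then show ?thesis using True a by (simp add: tail[OF U(1)[OF True]] ennreal_leI)
    qed simp
  qed
  moreover have "0 < ennreal (?l * (2 * d))"
  proof -
    have "\<bar>z\<bar> + d > 0" using d by simp
    then have "0 < ?l * (2 * d)" using a d by simp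
    then show ?thesis by (simp only: ennreal_less_zero_iff)
  qed
  ultimately show "0 < emeasure \<nu> ?U"
    using a by (subst (asm) ce) (simp, erule (1) less_le_trans[rotated])
  have "emeasure \<nu> ?U \<le> (\<integral>\<^sup>+r. ennreal ?u * indicator ?U r \<partial>lborel)"
    unfolding e
  proof (rule nn_integral_mono)
    fix r
    show "ennreal (k r) * indicator ?U r \<le> ennreal ?u * indicator ?U r"
    proof (cases "r \<in> ?U")
      case True
      then have "\<bar>r\<bar> powr (- \<alpha> - 1) \<le> r0 powr (- \<alpha> - 1)"
        using U[OF True] a by (intro powr_mono2') auto
      then show ?thesis using True a by (simp add: tail[OF U(1)[OF True]] ennreal_leI)
    qed simp
  qed
  then show "emeasure \<nu> ?U \<le> ennreal (?u * (2 * d))" using a by (subst (asm) ce) auto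
qed

text \<open>Membership in the range of \<open>j\<close> propagates forward in time, because
  \<open>SE\<close> acts as \<open>S\<close> on that range. So arbitrarily small times reach every
  \<open>t > 0\<close>, and continuity at \<open>t\<close> is that of the \<open>S\<close>-orbit
  starting from \<open>g (t / 2)\<close>.\<close>

lemma exists_semigroup_orbit:
  fixes j :: "'a::real_normed_vector \<Rightarrow> 'e::banach"
  assumes S: "strongly_continuous_semigroup S" and SE: "extended_semigroup S j SE"
    and dense: "closure (range j) = UNIV" and j: "inj j"
    and reg: "\<And>e. e > 0 \<Longrightarrow> \<exists>t. 0 < t \<and> t < e \<and> SE t b \<in> range j"
  obtains g where "\<And>t. t > 0 \<Longrightarrow> j (g t) = SE t b" "continuous_on {0<..} g"
      "\<And>r t. r \<ge> 0 \<Longrightarrow> t > 0 \<Longrightarrow> g (r + t) = S r (g t)"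
proof -
  have bl: "SE r (j x) = j (S r x)" if "r \<ge> 0" for r x
    using SE that by (auto simp: extended_semigroup_def)
  have ex: "\<exists>x. j x = SE t b" if t: "t > 0" for t
  proof -
    obtain s where s: "0 < s" "s < t" "SE s b \<in> range j" using reg[OF t] by blast
    then obtain x where x: "SE s b = j x" by auto
    have "SE t b = SE (t - s) (SE s b)"
      using extended_semigroup_add[OF S SE dense, of "t - s" s b] s by simp
    then show ?thesis using x bl[of "t - s" x] s by auto
  qed
  then obtain g where g: "\<And>t. t > 0 \<Longrightarrow> j (g t) = SE t b" by metis
  have add: "g (r + t) = S r (g t)" if "r \<ge> 0" "t > 0" for r t
  proof -
    have "j (g (r + t)) = SE r (SE t b)"
      using that extended_semigroup_add[OF S SE dense, of r t b] by (simp add: g)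
    also have "\<dots> = j (S r (g t))" using that by (simp add: bl flip: g)
    finally show ?thesis using j by (simp add: inj_eq)
  qed
  have "continuous_on {0<..} g"
  proof (rule continuous_at_imp_continuous_on, rule ballI)
    fix t :: real assume "t \<in> {0<..}"
    then have t: "t > 0" by simp
    have "continuous_on {0..} (\<lambda>s. S s (g (t / 2)))"
      using S by (simp add: strongly_continuous_semigroup_def)
    then have "continuous_on {t / 2<..} (\<lambda>s. S (s - t / 2) (g (t / 2)))"
      by (rule continuous_on_compose2) (auto intro!: continuous_intros)
    moreover have "S (s - t / 2) (g (t / 2)) = g s" if "s \<in> {t / 2<..}" for s
      using add[of "s - t / 2" "t / 2"] t that by simp
    ultimately have "continuous_on {t / 2<..} g" 
      by (rule continuous_on_eq)
    then show "isCont g t" using t by (simp add: continuous_on_eq_continuous_at)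
  qed
  with g add that show thesis by blast
qed

theorem theorem2p4:
  fixes S :: "real \<Rightarrow> 'a \<Rightarrow> 'a::{real_inner, complete_space}"
    and D :: "'a set" and A :: "'a \<Rightarrow> 'a"
    and l0 \<gamma> :: real
    and j :: "'a \<Rightarrow> 'e::banach" and SE :: "real \<Rightarrow> 'e \<Rightarrow> 'e"
    and B :: "real \<Rightarrow> 'e"
    and M :: "'w measure" and F :: "real \<Rightarrow> 'w measure"
    and \<nu> :: "real measure" and \<eta> :: "'w \<Rightarrow> (real \<times> real) measure"
    and k :: "real \<Rightarrow> real" and \<alpha> K0 r0 T :: real
    and x :: 'a and u :: "real \<Rightarrow> 'w \<Rightarrow> 'a"
  assumes "strongly_continuous_semigroup S" and "is_generator S D A"
    and "exceeds_growth_bound S l0" and "0 \<le> \<gamma>" and "\<gamma> < 1/2"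
    and "extrapolation_space D A l0 \<gamma> j" and "extended_semigroup S j SE"
    and "bounded_linear B"
    and "usual_conditions M F" and "levy_measure \<nu>" and "poisson_random_measure M F \<nu> \<eta>"
    and "T > 0"
    and "approx_null_controllable S j SE B T"
    and "k \<in> borel_measurable borel" and "\<And>r. k r \<ge> 0"
    and "\<nu> = density lborel (\<lambda>r. ennreal (k r))"
    and "1 < \<alpha>" and "\<alpha> \<le> 2" and "K0 > 0" and "r0 > 0"
    and "\<And>r. \<bar>r\<bar> \<ge> r0 \<Longrightarrow> k r = K0 * \<bar>r\<bar> powr (- \<alpha> - 1)"
    and "spde_mild_solution M F \<nu> \<eta> S j SE B x u"
  shows "\<forall>\<delta>>0. \<exists>\<kappa>>0. measure M {\<omega>\<in>space M. u T \<omega> \<in> cball 0 \<delta>} \<ge> \<kappa>"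
proof (intro allI impI)
  fix \<delta> :: real assume \<delta>: "\<delta> > 0"
  note S = assms(1) and gen = assms(2) and ext = assms(6) and SEx = assms(7) and B = assms(8)
    and T = assms(12) and ctrl = assms(13) and k = assms(14) and \<nu> = assms(16) and tail = assms(21)
  have a: "1 < \<alpha>" "K0 > 0" "r0 > 0" using assms by auto
  have "prob_space M" and sub: "subalgebra M (F T)"
    using assms(9) T by (auto simp: usual_conditions_def)
  then interpret prob_space M by simp
  interpret poisson_random M F \<nu> \<eta> by standard (rule assms(11))
  have jb: "bounded_linear j"
    using assms(5) by (intro extrapolation_embedding_bounded_linear[OF S gen assms(3,4) _ ext]) simp
  have ji: "inj j" and dense: "closure (range j) = UNIV"
    using ext by (auto simp: extrapolation_space_def is_completion_def)
  interpret j: bounded_linear j by fact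
  have SEbl: "bounded_linear (SE t)" "SE t (j y) = j (S t y)" if "t \<ge> 0" for t y
    using SEx that by (auto simp: extended_semigroup_def)
  define b where "b = B 1"
  have Bb: "B z = z *\<^sub>R b" for z
    using linear_simps(5)[OF B, of z 1] by (simp add: b_def)
  have SEB: "SE t (B z) = z *\<^sub>R SE t b" if "t \<ge> 0" for t z
    unfolding Bb by (rule linear_simps(5)[OF SEbl(1)[OF that]])
  obtain \<Phi> X where \<Phi>: "AE (z, s) in C. if s \<in> {0..T} then j (\<Phi> (z, s)) = SE (T - s) (B z) else \<Phi> (z, s) = 0"
    and I: "compensated_integral M \<nu> \<eta> \<Phi> X" and u: "AE \<omega> in M. u T \<omega> = S T x + X \<omega>"
    and uF: "u T \<in> borel_measurable (F T)"
    using assms(22) T unfolding spde_mild_solution_def by (meson less_imp_le)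
  have X: "X \<in> borel_measurable M" using I by (simp add: compensated_integral_def)
  have sets\<nu>: "sets \<nu> = sets borel" by (simp add: \<nu>)
  have rect: "U \<times> W \<in> sets C" if "U \<in> sets borel" "W \<in> sets borel" for U W
    using that sets\<nu> unfolding compensator_def by (intro pair_measureI) auto
  \<comment> \<open>If \<open>SE t b\<close> left the range of \<open>j\<close> at all small times,
    the equation for \<open>\<Phi>\<close> would fail on a rectangle of positive intensity.\<close>
  have reg: "\<exists>t. 0 < t \<and> t < e \<and> SE t b \<in> range j" if e: "e > 0" for e
  proof (rule ccontr)
    assume no: "\<not> ?thesis"
    \<comment> \<open>Jump times in \<open>{c<..<T}\<close> leave a remaining time between 0 and
      \<open>e\<close>. The jump sizes form the interval of radius 1 around \<open>r0 + 1\<close>,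
      which lies in the tail and away from 0.\<close>
    define c where "c = T - min e T / 2"
    let ?G = "{r0 + 1 - 1..r0 + 1 + 1} \<times> {c<..<T}"
    have c: "0 \<le> c" "c < T" "T - c < e" using e T by (auto simp: c_def)
    have "AE p in C. p \<notin> ?G"
      using \<Phi>
    proof eventually_elim
      case (elim p)
      obtain z s where p: "p = (z, s)" by force
      show ?case
      proof
        assume "p \<in> ?G"
        then have zs: "z \<noteq> 0" "0 \<le> s" "0 < T - s" "T - s < e" using p c a(3) by auto
        then have "j (\<Phi> (z, s)) = z *\<^sub>R SE (T - s) b" using elim p by (simp add: SEB)
        then have "SE (T - s) b = j (\<Phi> (z, s) /\<^sub>R z)" using zs by (simp add: j.scaleR)
        then show False using no zs by blast
      qed
    qed
    then have "emeasure C ?G = 0"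
      using rect by (subst (asm) AE_iff_measurable[OF _ refl]) (auto simp: compensator_def space_pair_measure \<nu>)
    moreover have "emeasure C ?G = emeasure \<nu> {r0 + 1 - 1..r0 + 1 + 1} * emeasure lborel {c<..<T}"
    proof -
      have "{c<..<T} \<inter> {0..} = {c<..<T}" using c by auto
      then show ?thesis by (subst emeasure_compensator_Times) (auto simp: sets\<nu>)
    qed
    moreover have "0 < emeasure \<nu> {r0 + 1 - 1..r0 + 1 + 1}"
      by (rule emeasure_tail_interval(1)[OF k \<nu> tail a]) (use a in auto)
    ultimately show False using c by simp
  qed
  obtain g where g: "\<And>t. t > 0 \<Longrightarrow> j (g t) = SE t b" "continuous_on {0<..} g"
      "\<And>r t. r \<ge> 0 \<Longrightarrow> t > 0 \<Longrightarrow> g (r + t) = S r (g t)"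
    using exists_semigroup_orbit[OF S SEx dense ji reg] by blast
  have \<Phi>g: "AE p in C. snd p \<in> {0..<T} \<longrightarrow> \<Phi> p = fst p *\<^sub>R g (T - snd p)"
    using \<Phi>
  proof eventually_elim
    case (elim p)
    obtain z s where p: "p = (z, s)" by force
    show ?case
    proof
      assume "snd p \<in> {0..<T}"
      then have s: "s \<in> {0..<T}" by (simp add: p)
      then have "j (\<Phi> p) = z *\<^sub>R SE (T - s) b" using elim by (simp add: p SEB)
      also have "\<dots> = j (z *\<^sub>R g (T - s))" using s by (simp add: g(1) j.scaleR)
      finally show "\<Phi> p = fst p *\<^sub>R g (T - snd p)" using ji by (simp add: inj_eq p)
    qed
  qed
  define V where "V = closure (span (g ` {0<..<T}))"
  have V: "subspace V" "closed V" unfolding V_def by (simp_all add: closure_span_subspace)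
  have \<Phi>V: "AE p in C. \<Phi> p \<in> V"
    using \<Phi> \<Phi>g AE_compensator_time_neq[of 0 \<nu>] AE_compensator_time_neq[of T \<nu>]
  proof eventually_elim
    case (elim p)
    obtain z s where p: "p = (z, s)" by force
    show ?case
    proof (cases "s \<in> {0..T}")
      case True
      then have "\<Phi> p = z *\<^sub>R g (T - s)" "T - s \<in> {0<..<T}" using elim by (auto simp: p)
      then have "\<Phi> p \<in> span (g ` {0<..<T})" by (simp only:) (intro span_scale span_base imageI)
      then show ?thesis unfolding V_def using closure_subset by blast
    next
      case False
      then show ?thesis using elim subspace_0[OF V(1)] by (auto simp: p)
    qed
  qed
  have jump: "z *\<^sub>R g t \<in> shifts X" if z: "\<bar>z\<bar> > r0" and t: "t \<in> {0<..<T}" for z t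
  proof (rule jump_in_shifts[OF I])
    fix e :: real assume e: "e > 0"
    let ?\<Psi> = "\<lambda>p::real \<times> real. fst p *\<^sub>R g (T - snd p)"
    have cont: "continuous_on (UNIV \<times> {0<..<T}) ?\<Psi>"
      by (intro continuous_intros continuous_on_compose2[OF g(2)]) auto
    have "isCont ?\<Psi> (z, T - t)"
      using continuous_on_eq_continuous_at[THEN iffD1, OF _ cont] t by (auto simp: open_Times)
    then obtain d0 where d0: "d0 > 0" "\<And>p. dist p (z, T - t) < d0 \<Longrightarrow> dist (?\<Psi> p) (?\<Psi> (z, T - t)) < e"
      unfolding continuous_at_eps_delta using e by blast
    let ?u = "K0 * r0 powr (- \<alpha> - 1)"
    \<comment> \<open>In order, the bounds keep the rectangle where \<open>?\<Psi>\<close> is within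
      \<open>e\<close> of its value at \<open>(z, T - t)\<close>, keep jump times below
      \<open>T\<close>, and keep jump sizes in the tail. The last two bring the intensity, at most
      \<open>2 * ?u * d * d\<close>, below \<open>e\<close>.\<close>
    define d where "d = Min {d0 / 3, t / 2, \<bar>z\<bar> - r0, 1 / 2, e / (?u + 1)}"
    have u0: "?u \<ge> 0" using a by simp
    have dle: "d \<le> d0 / 3" "d \<le> t / 2" "d \<le> \<bar>z\<bar> - r0" "d \<le> 1 / 2" "d \<le> e / (?u + 1)"
      unfolding d_def by (rule Min_le; simp)+
    have "e / (?u + 1) > 0" using e u0 by (simp add: add_nonneg_pos)
    then have d: "d > 0" using d0(1) t z by (simp add: d_def)
    define G where "G = {z - d..z + d} \<times> {T - t..T - t + d}"
    have "emeasure C G = emeasure \<nu> {z - d..z + d} * emeasure lborel {T - t..T - t + d}"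
    proof -
      have "{T - t..T - t + d} \<inter> {0..} = {T - t..T - t + d}" using t by auto
      then show ?thesis unfolding G_def by (subst emeasure_compensator_Times) (auto simp: sets\<nu>)
    qed
    then have CG: "emeasure C G = emeasure \<nu> {z - d..z + d} * ennreal d" using d by simp
    have \<nu>U: "0 < emeasure \<nu> {z - d..z + d}" "emeasure \<nu> {z - d..z + d} \<le> ennreal (?u * (2 * d))"
      using emeasure_tail_interval[OF k \<nu> tail a d, of z] dle(3) by auto
    show "\<exists>G\<in>sets C. 0 < emeasure C G \<and> emeasure C G \<le> ennreal e \<and>
        (AE p in C. p \<in> G \<longrightarrow> norm (\<Phi> p - z *\<^sub>R g t) \<le> e)"
    proof (intro bexI[of _ G] conjI)
      show "G \<in> sets C" unfolding G_def by (rule rect) auto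
      show "0 < emeasure C G" using \<nu>U(1) d by (simp add: CG ennreal_zero_less_mult_iff)
      have "emeasure C G \<le> ennreal (?u * (2 * d)) * ennreal d"
        unfolding CG by (rule mult_right_mono[OF \<nu>U(2)]) simp
      also have "\<dots> = ennreal (?u * (2 * d) * d)" using u0 d by (simp add: ennreal_mult')
      also have "\<dots> \<le> ennreal e"
      proof (rule ennreal_leI)
        have "?u * (2 * d) * d \<le> ?u * 1 * d" using u0 d dle(4) by (intro mult_right_mono mult_left_mono) auto
        also have "\<dots> \<le> (?u + 1) * d" using d by (simp add: algebra_simps)
        also have "\<dots> \<le> e" using dle(5) u0 by (simp add: pos_le_divide_eq add_nonneg_pos mult.commute)
        finally show "?u * (2 * d) * d \<le> e" .
      qed
      finally show "emeasure C G \<le> ennreal e" .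
      show "AE p in C. p \<in> G \<longrightarrow> norm (\<Phi> p - z *\<^sub>R g t) \<le> e"
        using \<Phi>g
      proof eventually_elim
        case (elim p)
        show ?case
        proof
          assume "p \<in> G"
          then obtain z' s where p: "p = (z', s)" "\<bar>z' - z\<bar> \<le> d" "T - t \<le> s" "s \<le> T - t + d"
            by (auto simp: G_def abs_le_iff)
          have "s \<in> {0..<T}" using p(3,4) t dle(2) by auto
          then have \<Phi>p: "\<Phi> p = ?\<Psi> p" using elim by (simp add: p(1))
          have "dist p (z, T - t) \<le> dist z' z + dist s (T - t)"
            unfolding p(1) dist_Pair_Pair by (rule sqrt_sum_squares_le_sum) auto
          also have "\<dots> < d0" using p dle(1) d0(1) unfolding dist_real_def by linarith
          finally have "dist (?\<Psi> p) (?\<Psi> (z, T - t)) < e" by (rule d0(2))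
          then show "norm (\<Phi> p - z *\<^sub>R g t) \<le> e" by (simp add: \<Phi>p dist_norm)
        qed
      qed
    qed
  qed
  \<comment> \<open>Any \<open>c\<close> is the sum of \<open>c + r0 + 1\<close> and
    \<open>- r0 - 1\<close>, or of \<open>c - r0 - 1\<close> and \<open>r0 + 1\<close>. The sign of
    \<open>c\<close> decides in which splitting both moduli exceed \<open>r0\<close>.\<close>
  have scal: "c *\<^sub>R g t \<in> shifts X" if t: "t \<in> {0<..<T}" for c t
  proof (cases "c \<ge> 0")
    case True
    have "(c + r0 + 1) *\<^sub>R g t + (- r0 - 1) *\<^sub>R g t \<in> shifts X"
      by (intro shifts_add jump t) (use True a(3) in auto)
    then show ?thesis by (simp flip: scaleR_add_left)
  next
    case False
    have "(c - r0 - 1) *\<^sub>R g t + (r0 + 1) *\<^sub>R g t \<in> shifts X"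
      by (intro shifts_add jump t) (use False a(3) in auto)
    then show ?thesis by (simp flip: scaleR_add_left)
  qed
  have "span (g ` {0<..<T}) \<subseteq> shifts X"
  proof
    fix h assume "h \<in> span (g ` {0<..<T})"
    then show "h \<in> shifts X"
    proof (induction rule: span_induct_alt)
      case base
      \<comment> \<open>The zero shift is also obtained from jumps, so some time in the interval has
        to be exhibited.\<close>
      have "T / 2 \<in> {0<..<T}" using T by simp
      from scal[OF this, of 0] show ?case by simp
    next
      case (step c y h)
      then show ?case using scal by (auto intro!: shifts_add)
    qed
  qed
  then have VX: "V \<subseteq> shifts X"
    unfolding V_def using closure_shifts_subset[OF X] closure_mono by blast
  have orbit_ctrl: "h \<in> V" if v: "L2_on T v" and h: "((\<lambda>s. SE (T - s) (B (v s))) has_integral j h) {0..T}" for v h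
    unfolding V_def
  proof (rule control_integral_in_orbit_span[where SE = SE and b = b and v = v])
    show "((\<lambda>s. SE (T - s) (v s *\<^sub>R b)) has_integral j h) {0..T}" using h by (simp add: Bb)
  qed (rule S T L2_on_integrable[OF v] jb ji SEbl g extended_semigroup_add[OF S SEx dense] | assumption)+
  \<comment> \<open>A control steering \<open>x\<close> to a small \<open>y\<close> shows
    \<open>y - S T x\<close> to be in \<open>V\<close>; hence \<open>S T x\<close> is within
    \<open>norm y\<close> of \<open>V\<close>.\<close>
  have "S T x \<in> closure V"
    unfolding closure_approachable
  proof (intro allI impI)
    fix e :: real assume e: "e > 0"
    obtain v uc y where v: "L2_on T v" "control_mild_solution S j SE B T x v uc" "uc T = j y" "norm y \<le> e / 2"
      using ctrl e unfolding approx_null_controllable_def by (meson half_gt_zero)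
    have "((\<lambda>s. SE (T - s) (B (v s))) has_integral (uc T - j (S T x))) {0..T}"
      using v(2) T by (simp add: control_mild_solution_def)
    then have "y - S T x \<in> V" by (intro orbit_ctrl[OF v(1)]) (simp add: v(3) j.diff)
    then have "- (y - S T x) \<in> V" using V(1) by (rule subspace_neg[rotated])
    moreover have "dist (- (y - S T x)) (S T x) < e" using v(4) e by (simp add: dist_norm)
    ultimately show "\<exists>q\<in>V. dist q (S T x) < e" by blast
  qed
  then have "S T x \<in> V" using V(2) by simp
  then have "- S T x \<in> V" using V(1) by (simp add: subspace_neg)
  then have pos: "0 < prob {\<omega>\<in>space M. norm (X \<omega> - (- S T x)) < \<delta>}"
    by (intro prob_ball_pos_of_shifts[OF I V \<Phi>V VX] \<delta>)
  have uM: "u T \<in> borel_measurable M" by (rule measurable_from_subalg[OF sub uF])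
  \<comment> \<open>Almost surely \<open>X + S T x\<close> is the solution at time \<open>T\<close>,
    so the ball around \<open>- S T x\<close> becomes the ball around 0.\<close>
  have "prob {\<omega>\<in>space M. norm (X \<omega> - (- S T x)) < \<delta>} \<le> prob {\<omega>\<in>space M. u T \<omega> \<in> cball 0 \<delta>}"
  proof (rule finite_measure_mono_AE)
    have "u T -` cball 0 \<delta> \<inter> space M \<in> sets M" by (rule measurable_sets[OF uM]) simp
    moreover have "u T -` cball 0 \<delta> \<inter> space M = {\<omega>\<in>space M. u T \<omega> \<in> cball 0 \<delta>}" by auto
    ultimately show "{\<omega>\<in>space M. u T \<omega> \<in> cball 0 \<delta>} \<in> sets M" by simp
    show "AE \<omega> in M. \<omega> \<in> {\<omega>\<in>space M. norm (X \<omega> - (- S T x)) < \<delta>} \<longrightarrow> \<omega> \<in> {\<omega>\<in>space M. u T \<omega> \<in> cball 0 \<delta>}"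
      using u by eventually_elim (auto simp: add.commute)
  qed
  then show "\<exists>\<kappa>>0. measure M {\<omega>\<in>space M. u T \<omega> \<in> cball 0 \<delta>} \<ge> \<kappa>" using pos by blast
qed

end
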